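(* Let $p$ be a prime, and let $q$ be a power of $p$. (1) Suppose $p>2$ and $\Gamma$ is a $p$-irregular subgroup of $\mathrm{PGL}_2(\mathbb{F}_q)$. Let $\hat\Gamma$ be the preimage of $\Gamma$ in $\mathrm{SL}_2(\mathbb{F}_{q^2})$. Then every rational map $f:\mathbb{P}^1\to\mathbb{P}^1$ over $\bar{\mathbb{F}}_p$ with $\deg(f)\ge2$ and $\Gamma\subseteq\mathrm{Aut}(f)$ arises in the form $$[x:y]\mapsto\left[xF+\frac{\partial G}{\partial y}: yF-\frac{\partial G}{\partial x}\right],$$ where $F$ and $G$ are homogeneous, relatively invariant polynomials over $\bar{\mathbb{F}}_p$ for the same character of $\hat\Gamma$, such that $\deg(F)+1=\deg(G)-1=\deg(f)$. (2) Let $p\ge2$. Let $F$ and $G$ be homogeneous, relatively invariant polynomials over $\bar{\mathbb{F}}_p$ for the same character of a subgroup $\Gamma\subseteq\mathrm{SL}_2(\mathbb{F}_q)$. Let $\bar\Gamma$ be the image of $\Gamma$ in $\mathrm{PSL}_2(\mathbb{F}_q)$. If the expressions $xF+\frac{\partial G}{\partial y}$ and $yF-\frac{\partial G}{\partial x}$ are nontrivial homogeneous polynomials of the same degree, then the corresponding rational map $$f=\left[xF+\frac{\partial G}{\partial y}: yF-\frac{\partial G}{\partial x}\right]$$ has $\bar\Gamma\subseteq\mathrm{Aut}(f)$.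
   Context: A finite subgroup of $\mathrm{PGL}_2(\bar{\mathbb{F}}_p)$ is $p$-irregular if $p$ divides its order. For $\alpha\in\mathrm{PGL}_2(\bar{\mathbb{F}}_p)$, $f^\alpha=\alpha^{-1}\circ f\circ\alpha$ and $\mathrm{Aut}(f)=\{\alpha\in\mathrm{PGL}_2(\bar{\mathbb{F}}_p):f^\alpha=f\}$. In (1), $\Gamma$ is viewed inside $\mathrm{PSL}_2(\mathbb{F}_{q^2})$ (every element of $\mathrm{PGL}_2(\mathbb{F}_q)$ lifts to $\mathrm{SL}_2(\mathbb{F}_{q^2})$). For a group $H$ of invertible $2\times2$ matrices over $\bar{\mathbb{F}}_p$ and a character (homomorphism) $\chi:H\to\bar{\mathbb{F}}_p^{*}$, a polynomial $F\in\bar{\mathbb{F}}_p[x,y]$ is relatively invariant for $\chi$ if $F\circ h=\chi(h)F$ for all $h\in H$. By convention the zero polynomial is homogeneous of every degree. Any common factor of the two coordinate polynomials defining a rational map is cancelled. *)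

theory Defs
  imports
    "HOL-Analysis.Determinants"
    "HOL-Algebra.Coset"
    "HOL-Computational_Algebra.Computational_Algebra"
begin

text \<open>The type \<^typ>\<open>'a\<close> is an algebraic closure of the prime field with \<open>p\<close> elements, which
  in characteristic \<open>p\<close> is \<open>\<int>\<close>, the range of \<^const>\<open>of_int\<close>.\<close>

definition is_alg_closure_Fp :: "nat \<Rightarrow> 'a::alg_closed_field itself \<Rightarrow> bool" where
  "is_alg_closure_Fp p _ \<longleftrightarrow>
     CHAR('a) = p \<and>
     (\<forall>x::'a. \<exists>f::'a poly. f \<noteq> 0 \<and> (\<forall>i. coeff f i \<in> \<int>) \<and> poly f x = 0)"

text \<open>For a power \<open>q > 1\<close> of the characteristic this is the unique subfield of order \<open>q\<close>.\<close>

definition Fq :: "nat \<Rightarrow> 'a::field set" where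
  "Fq q = {a. a ^ q = a}"

definition mult_group :: "'a::field monoid" where
  "mult_group = \<lparr>carrier = {c. c \<noteq> 0}, mult = (*), one = 1\<rparr>"

definition GL2 :: "('a::field ^ 2 ^ 2) monoid" where
  "GL2 = \<lparr>carrier = {A. invertible A}, mult = (**), one = mat 1\<rparr>"

definition scalars :: "('a::field ^ 2 ^ 2) set" where
  "scalars = {mat c |c. c \<noteq> 0}"

definition matrices_over :: "'a::field set \<Rightarrow> ('a ^ 2 ^ 2) set" where
  "matrices_over k = {A. \<forall>i j. A $ i $ j \<in> k}"

definition SL2 :: "'a::field set \<Rightarrow> ('a ^ 2 ^ 2) monoid" where
  "SL2 k = GL2\<lparr>carrier := {A \<in> matrices_over k. det A = 1}\<rparr>"

definition proj :: "'a::field ^ 2 ^ 2 \<Rightarrow> ('a ^ 2 ^ 2) set" where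
  "proj A = scalars #>\<^bsub>GL2\<^esub> A"

text \<open>For a subfield \<open>k\<close>, the groups \<open>PGL\<^sub>2(k)\<close> and \<open>PSL\<^sub>2(k)\<close> are regarded as subgroups of
  \<open>PGL\<^sub>2\<close> over the whole field, namely as the images of \<open>GL\<^sub>2(k)\<close> and \<open>SL\<^sub>2(k)\<close> under
  \<^const>\<open>proj\<close>.  The full group is \<open>PGL2 UNIV\<close>.\<close>

definition PGL2 :: "'a::field set \<Rightarrow> ('a ^ 2 ^ 2) set monoid" where
  "PGL2 k = (GL2 Mod scalars)\<lparr>carrier := proj ` (carrier GL2 \<inter> matrices_over k)\<rparr>"

definition p_irregular :: "nat \<Rightarrow> ('a::field ^ 2 ^ 2) set set \<Rightarrow> bool" where
  "p_irregular p \<Gamma> \<longleftrightarrow> subgroup \<Gamma> (PGL2 UNIV) \<and> finite \<Gamma> \<and> p dvd card \<Gamma>"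

definition SL2_preimage :: "'a::field set \<Rightarrow> ('a ^ 2 ^ 2) set set \<Rightarrow> ('a ^ 2 ^ 2) set" where
  "SL2_preimage k \<Gamma> = {A \<in> carrier (SL2 k). proj A \<in> \<Gamma>}"

text \<open>The coefficient of \<open>x\<^sup>i y\<^sup>j\<close> in \<open>F\<close> is \<^term>\<open>coeff (coeff F j) i\<close>.\<close>

type_synonym 'a poly2 = "'a poly poly"

definition const2 :: "'a::field \<Rightarrow> 'a poly2" where
  "const2 a = [:[:a:]:]"

definition var_x :: "'a::field poly2" where
  "var_x = [:[:0, 1:]:]"

definition var_y :: "'a::field poly2" where
  "var_y = [:0, 1:]"

definition d_dx :: "'a::field poly2 \<Rightarrow> 'a poly2" where
  "d_dx F = map_poly pderiv F"

definition d_dy :: "'a::field poly2 \<Rightarrow> 'a poly2" where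
  "d_dy F = pderiv F"

definition homogeneous :: "nat \<Rightarrow> 'a::field poly2 \<Rightarrow> bool" where
  "homogeneous d F \<longleftrightarrow> (\<forall>i j. coeff (coeff F j) i \<noteq> 0 \<longrightarrow> i + j = d)"

text \<open>The polynomial \<open>F(P, Q)\<close>.\<close>

definition subst2 :: "'a::field poly2 \<Rightarrow> 'a poly2 \<Rightarrow> 'a poly2 \<Rightarrow> 'a poly2" where
  "subst2 F P Q = poly (map_poly (\<lambda>c. poly (map_poly const2 c) P) F) Q"

text \<open>\<open>F \<circ> A\<close>, where a matrix acts on the column vector with entries \<open>x\<close>, \<open>y\<close>.\<close>

definition comp_mat :: "'a::field poly2 \<Rightarrow> 'a ^ 2 ^ 2 \<Rightarrow> 'a poly2" where
  "comp_mat F A =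
     subst2 F (const2 (A $ 1 $ 1) * var_x + const2 (A $ 1 $ 2) * var_y)
              (const2 (A $ 2 $ 1) * var_x + const2 (A $ 2 $ 2) * var_y)"

definition is_character :: "('a::field ^ 2 ^ 2) set \<Rightarrow> ('a ^ 2 ^ 2 \<Rightarrow> 'a) \<Rightarrow> bool" where
  "is_character H \<psi> \<longleftrightarrow> \<psi> \<in> hom (GL2\<lparr>carrier := H\<rparr>) mult_group"

definition relatively_invariant ::
  "('a::field ^ 2 ^ 2) set \<Rightarrow> ('a ^ 2 ^ 2 \<Rightarrow> 'a) \<Rightarrow> 'a poly2 \<Rightarrow> bool" where
  "relatively_invariant H \<psi> F \<longleftrightarrow> (\<forall>h\<in>H. comp_mat F h = const2 (\<psi> h) * F)"

text \<open>A rational map is a class of pairs of forms of equal degree, not both zero, up to common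
  factors: \<open>[P : Q] = [P' : Q']\<close> iff \<open>P Q' = P' Q\<close>.\<close>

definition form_pairs :: "('a::field poly2 \<times> 'a poly2) set" where
  "form_pairs = {(P, Q). (P \<noteq> 0 \<or> Q \<noteq> 0) \<and> (\<exists>d. homogeneous d P \<and> homogeneous d Q)}"

definition form_pairs_rel ::
  "(('a::field poly2 \<times> 'a poly2) \<times> ('a poly2 \<times> 'a poly2)) set" where
  "form_pairs_rel =
     {((P, Q), (P', Q')). (P, Q) \<in> form_pairs \<and> (P', Q') \<in> form_pairs \<and> P * Q' = P' * Q}"

lemma equiv_form_pairs_rel:
  "equiv (form_pairs :: ('a::field poly2 \<times> 'a poly2) set) form_pairs_rel"
proof (rule equivI)
  show "form_pairs_rel \<subseteq> form_pairs \<times> form_pairs"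
    by (auto simp: form_pairs_rel_def)
  show "refl_on form_pairs form_pairs_rel"
    by (auto simp: form_pairs_rel_def refl_on_def)
  show "sym form_pairs_rel"
    by (auto simp: form_pairs_rel_def sym_def)
  show "trans (form_pairs_rel :: (('a poly2 \<times> 'a poly2) \<times> _) set)"
  proof (rule transI)
    fix u v w :: "'a poly2 \<times> 'a poly2"
    assume uv: "(u, v) \<in> form_pairs_rel" and vw: "(v, w) \<in> form_pairs_rel"
    obtain P Q P' Q' P'' Q'' where eq: "u = (P, Q)" "v = (P', Q')" "w = (P'', Q'')"
      by (metis surj_pair)
    have 1: "P * Q' = P' * Q" and 2: "P' * Q'' = P'' * Q'" and nz: "P' \<noteq> 0 \<or> Q' \<noteq> 0"
      using uv vw by (auto simp: eq form_pairs_rel_def form_pairs_def)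
    have "Q' * (P * Q'') = (P * Q') * Q''"
      by (simp only: ac_simps)
    also have "\<dots> = (P' * Q'') * Q"
      unfolding 1 by (simp only: ac_simps)
    also have "\<dots> = Q' * (P'' * Q)"
      unfolding 2 by (simp only: ac_simps)
    finally have "Q' * (P * Q'') = Q' * (P'' * Q)" .
    moreover have "P' * (P * Q'') = P' * (P'' * Q)"
    proof -
      have "P' * (P * Q'') = P * (P' * Q'')"
        by (simp only: ac_simps)
      also have "\<dots> = (P * Q') * P''"
        unfolding 2 by (simp only: ac_simps)
      also have "\<dots> = P' * (P'' * Q)"
        unfolding 1 by (simp only: ac_simps)
      finally show ?thesis .
    qed
    ultimately have "P * Q'' = P'' * Q"
      using nz by auto
    then show "(u, w) \<in> form_pairs_rel"
      using uv vw by (auto simp: eq form_pairs_rel_def)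
  qed
qed

definition rational_maps :: "('a::field poly2 \<times> 'a poly2) set set" where
  "rational_maps = form_pairs // form_pairs_rel"

definition ratmap :: "'a::field poly2 \<Rightarrow> 'a poly2 \<Rightarrow> ('a poly2 \<times> 'a poly2) set" where
  "ratmap P Q = form_pairs_rel `` {(P, Q)}"

text \<open>The degree of the coordinate forms once all common factors are cancelled.\<close>

definition ratmap_degree :: "('a::field poly2 \<times> 'a poly2) set \<Rightarrow> nat" where
  "ratmap_degree f =
     (THE d. \<exists>(P, Q)\<in>f. coprime P Q \<and> homogeneous d P \<and> homogeneous d Q)"

text \<open>The coordinates of \<open>A\<inverse> \<circ> [P : Q] \<circ> A\<close>.\<close>

definition conj_pair ::
  "'a::field ^ 2 ^ 2 \<Rightarrow> 'a poly2 \<times> 'a poly2 \<Rightarrow> 'a poly2 \<times> 'a poly2" where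
  "conj_pair A = (\<lambda>(P, Q).
     let B = matrix_inv A; P' = comp_mat P A; Q' = comp_mat Q A in
       (const2 (B $ 1 $ 1) * P' + const2 (B $ 1 $ 2) * Q',
        const2 (B $ 2 $ 1) * P' + const2 (B $ 2 $ 2) * Q'))"

text \<open>\<open>f\<^sup>\<alpha> = \<alpha>\<inverse> \<circ> f \<circ> \<alpha>\<close> for an element \<open>\<alpha>\<close> of \<open>PGL\<^sub>2\<close>, which is a coset of matrices.  All choices
  of a matrix in \<open>\<alpha>\<close> and a pair in \<open>f\<close> give equivalent pairs, and together they fill the
  class \<open>f\<^sup>\<alpha>\<close>.\<close>

definition ratmap_conj ::
  "('a::field poly2 \<times> 'a poly2) set \<Rightarrow> ('a ^ 2 ^ 2) set \<Rightarrow> ('a poly2 \<times> 'a poly2) set" where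
  "ratmap_conj f \<alpha> = (\<Union>A\<in>\<alpha>. conj_pair A ` f)"

definition Aut :: "('a::field poly2 \<times> 'a poly2) set \<Rightarrow> ('a ^ 2 ^ 2) set set" where
  "Aut f = {\<alpha> \<in> carrier (PGL2 UNIV). ratmap_conj f \<alpha> = f}"

end

theory Submission
  imports Defs "HOL-Algebra.Sylow" "HOL-Algebra.Multiplicative_Group"
begin

text \<open>Regard a pair \<open>v = (P, Q)\<close> of forms of degree \<open>d\<close> as a vector field on the plane. The map
  \<open>[P : Q]\<close> commutes with a matrix \<open>A\<close> iff \<open>v \<circ> A\<close> is proportional to \<open>A v\<close>. If
  \<open>det A = 1\<close>, then \<open>(x, y)\<close> has this property and so has the rotated gradient
  \<open>(G\<^sub>y, - G\<^sub>x)\<close> of an invariant \<open>G\<close>; hence \<open>F (x, y) + (G\<^sub>y, - G\<^sub>x)\<close> has it whenever \<open>F\<close>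
  and \<open>G\<close> share a character. This is \<open>invariants_give_automorphism\<close>.

  Conversely, let \<open>v\<close> be a coprime pair of coordinates of \<open>f\<close>. Two coprime pairs for the same map
  differ by a constant, so each automorphism acts on \<open>v\<close> by an eigenvalue
  (\<open>conj_pair_eigenvalue\<close>), and these eigenvalues form a character. The divergence
  \<open>P\<^sub>x + Q\<^sub>y\<close> and the determinant \<open>y P - x Q\<close> are relatively invariant for it, and Euler's identity
  shows that, divided by \<open>d + 1\<close>, they serve as \<open>F\<close> and \<open>G\<close>
  (\<open>pair_from_determinant_divergence\<close>).

  It remains to exclude that \<open>p\<close> divides \<open>d + 1\<close>, and this is where irregularity enters. By Cauchy's
  theorem the group contains an element of order \<open>p\<close>, which in characteristic \<open>p\<close> is a translation
  \<open>x \<mapsto> x + b\<close> in suitable coordinates (\<open>p_irregular_translation\<close>). Comparing the top coefficients of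
  \<open>v(x + b, 1)\<close> with those of \<open>v(x, 1)\<close> gives \<open>d (d - 1) = 0\<close> modulo \<open>p\<close>
  (\<open>p_irregular_degree\<close>), whereas \<open>d = - 1\<close> would give \<open>d (d - 1) = 2\<close>.

  Coprime coordinates and their uniqueness rest on Euclid's lemma for forms
  (\<open>form_dvd_mult_cancel\<close>), which is proved by splitting off linear factors.\<close>

text \<open>The dollar sign selects matrix entries below; formal power series use the same symbol.\<close>

no_notation fps_nth (infixl "$" 75)
hide_const (open) up_ring.coeff up_ring.monom module.smult

section \<open>Substitution and partial derivatives\<close>

lemma const2_simps [simp]:
  "const2 0 = 0" "const2 1 = 1" "const2 (a + b) = const2 a + const2 b"
  "const2 (a * b) = const2 a * const2 b" "const2 (- a) = - const2 a"
  "const2 (a - b) = const2 a - const2 b" "const2 a = const2 b \<longleftrightarrow> a = b"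
  by (simp_all add: const2_def flip: one_pCons)

lemma const2_eq_0_iff [simp]: "const2 a = 0 \<longleftrightarrow> a = 0"
  by (simp add: const2_def)

lemma var_x_mult: "var_x * pCons c F = pCons ([:0, 1:] * c) (var_x * F)"
  by (simp add: var_x_def)

text \<open>Bivariate polynomials are generated by constants, addition, and multiplication by the two
  variables. An identity between maps that are additive and multiplicative need only be checked
  on these generators.\<close>

lemma poly2_induct [case_names const add x y]:
  fixes F :: "'a::field poly2"
  assumes const: "\<And>a. P (const2 a)"
    and add: "\<And>F G. P F \<Longrightarrow> P G \<Longrightarrow> P (F + G)"
    and x: "\<And>F. P F \<Longrightarrow> P (var_x * F)"
    and y: "\<And>F. P F \<Longrightarrow> P (var_y * F)"
  shows "P F"
proof (induction F)
  case 0
  show ?case using const[of 0] by simp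
next
  case (pCons c F)
  have "P [:c:]"
  proof (induction c)
    case 0
    show ?case using const[of 0] by simp
  next
    case (pCons a c)
    have "[:pCons a c:] = const2 a + var_x * [:c:]"
      by (simp add: const2_def var_x_def)
    then show ?case using add[OF const x] pCons by metis
  qed
  moreover have "pCons c F = [:c:] + var_y * F"
    by (simp add: var_y_def)
  ultimately show ?case using add y pCons by metis
qed

lemma poly_map_const2_add:
  "poly (map_poly const2 (c + c')) P = poly (map_poly const2 c) P + poly (map_poly const2 c') P"
  by (induction c c' rule: poly_induct2) (simp_all add: map_poly_pCons algebra_simps)

lemma poly_map_const2_smult:
  "poly (map_poly const2 (smult a c)) P = const2 a * poly (map_poly const2 c) P"
  by (induction c) (simp_all add: map_poly_pCons algebra_simps)

lemma subst2_0 [simp]: "subst2 0 P Q = 0"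
  by (simp add: subst2_def)

lemma subst2_pCons: "subst2 (pCons c F) P Q = poly (map_poly const2 c) P + Q * subst2 F P Q"
  by (simp add: subst2_def map_poly_pCons)

lemma subst2_const2 [simp]: "subst2 (const2 a) P Q = const2 a"
  by (simp add: const2_def subst2_pCons map_poly_pCons)

lemma subst2_add [simp]: "subst2 (F + G) P Q = subst2 F P Q + subst2 G P Q"
  by (induction F G rule: poly_induct2)
    (simp_all add: subst2_pCons poly_map_const2_add algebra_simps)

lemma subst2_const2_mult: "subst2 (const2 a * F) P Q = const2 a * subst2 F P Q"
proof (induction F)
  case (pCons c F)
  have "const2 a * pCons c F = pCons (smult a c) (const2 a * F)"
    by (simp add: const2_def)
  then show ?case
    using pCons by (simp add: subst2_pCons poly_map_const2_smult algebra_simps)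
qed simp

lemma map_poly_X_mult: "map_poly const2 ([:0, 1:] * c) = pCons 0 (map_poly const2 c)"
  by (simp add: map_poly_pCons)

lemma subst2_var_x_mult: "subst2 (var_x * F) P Q = P * subst2 F P Q"
proof (induction F)
  case (pCons c F)
  then show ?case
    by (simp del: mult_pCons_left mult_pCons_right
        add: var_x_mult subst2_pCons map_poly_X_mult distrib_left mult.left_commute)
qed simp

lemma subst2_var_y_mult: "subst2 (var_y * F) P Q = Q * subst2 F P Q"
  by (simp add: var_y_def subst2_pCons)

lemma subst2_mult [simp]: "subst2 (F * G) P Q = subst2 F P Q * subst2 G P Q"
  by (induction F rule: poly2_induct)
    (simp_all add: subst2_const2_mult subst2_var_x_mult subst2_var_y_mult distrib_right mult.assoc)

lemma subst2_var_x [simp]: "subst2 var_x P Q = P"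
  using subst2_var_x_mult[of 1 P Q] subst2_const2[of 1 P Q] by simp

lemma subst2_var_y [simp]: "subst2 var_y P Q = Q"
  using subst2_var_y_mult[of 1 P Q] subst2_const2[of 1 P Q] by simp

lemma comp_mat_simps [simp]:
  "comp_mat 0 A = 0" "comp_mat (const2 a) A = const2 a"
  "comp_mat (F + G) A = comp_mat F A + comp_mat G A"
  "comp_mat (F * G) A = comp_mat F A * comp_mat G A"
  "comp_mat var_x A = const2 (A $ 1 $ 1) * var_x + const2 (A $ 1 $ 2) * var_y"
  "comp_mat var_y A = const2 (A $ 2 $ 1) * var_x + const2 (A $ 2 $ 2) * var_y"
  by (simp_all add: comp_mat_def)

lemma comp_mat_1 [simp]: "comp_mat 1 A = 1"
  using comp_mat_simps(2)[of 1 A] by simp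

lemma comp_mat_diff [simp]: "comp_mat (F - G) A = comp_mat F A - comp_mat G A"
  using comp_mat_simps(3)[of "F - G" G A] by simp

lemma comp_mat_mat_1 [simp]: "comp_mat F (mat 1) = F"
  by (induction F rule: poly2_induct) (simp_all add: mat_def)

lemma comp_mat_comp_mat: "comp_mat (comp_mat F A) B = comp_mat F (A ** B)"
  by (induction F rule: poly2_induct)
    (simp_all add: matrix_matrix_mult_def sum_2 algebra_simps)

lemma coeff_d_dx: "coeff (d_dx F) j = pderiv (coeff F j)"
  by (simp add: d_dx_def coeff_map_poly)

lemma d_dx_simps [simp]:
  "d_dx 0 = 0" "d_dx (const2 a) = 0" "d_dx (F + G) = d_dx F + d_dx G"
  "d_dx (const2 a * F) = const2 a * d_dx F"
  "d_dx (var_x * F) = F + var_x * d_dx F" "d_dx (var_y * F) = var_y * d_dx F"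
  "d_dx (- F) = - d_dx F" "d_dx (F - G) = d_dx F - d_dx G"
proof -
  show "d_dx (var_x * F) = F + var_x * d_dx F"
    by (rule poly_eqI) (simp add: coeff_d_dx var_x_def pderiv_pCons)
  show "d_dx (var_y * F) = var_y * d_dx F"
    by (rule poly_eqI) (simp add: coeff_d_dx var_y_def coeff_pCons split: nat.splits)
  show "d_dx (const2 a) = 0"
    by (rule poly_eqI) (simp add: coeff_d_dx const2_def pderiv_pCons coeff_pCons split: nat.splits)
qed (rule poly_eqI, simp add: d_dx_def coeff_map_poly pderiv_add pderiv_smult pderiv_minus
      pderiv_diff const2_def)+

lemma d_dy_simps [simp]:
  "d_dy 0 = 0" "d_dy (const2 a) = 0" "d_dy (F + G) = d_dy F + d_dy G"
  "d_dy (const2 a * F) = const2 a * d_dy F"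
  "d_dy (var_x * F) = var_x * d_dy F" "d_dy (var_y * F) = F + var_y * d_dy F"
  "d_dy (- F) = - d_dy F" "d_dy (F - G) = d_dy F - d_dy G"
  by (simp_all add: d_dy_def const2_def var_x_def var_y_def pderiv_pCons pderiv_add pderiv_smult
      pderiv_minus pderiv_diff)

lemma d_dx_comp_mat:
  "d_dx (comp_mat F A) = const2 (A $ 1 $ 1) * comp_mat (d_dx F) A + const2 (A $ 2 $ 1) * comp_mat (d_dy F) A"
  by (induction F rule: poly2_induct) (simp_all add: distrib_right mult.assoc, simp_all add: algebra_simps)

lemma d_dy_comp_mat:
  "d_dy (comp_mat F A) = const2 (A $ 1 $ 2) * comp_mat (d_dx F) A + const2 (A $ 2 $ 2) * comp_mat (d_dy F) A"
  by (induction F rule: poly2_induct) (simp_all add: distrib_right mult.assoc, simp_all add: algebra_simps)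

section \<open>Inverses of two-by-two matrices\<close>

lemma matrix_inv_right_left:
  fixes A :: "'a::field ^ 2 ^ 2"
  assumes "invertible A"
  shows "A ** matrix_inv A = mat 1" "matrix_inv A ** A = mat 1"
  using someI_ex[OF assms[unfolded invertible_def]] by (auto simp: matrix_inv_def)

lemma invertible_matrix_inv: "invertible A \<Longrightarrow> invertible (matrix_inv (A :: 'a::field ^ 2 ^ 2))"
  using matrix_inv_right_left unfolding invertible_def by metis

lemma matrix_inv_eqI:
  fixes A :: "'a::field ^ 2 ^ 2"
  assumes "A ** B = mat 1" "B ** A = mat 1"
  shows "invertible A" "matrix_inv A = B"
proof -
  show inv: "invertible A"
    using assms unfolding invertible_def by blast
  have "matrix_inv A = (B ** A) ** matrix_inv A"
    by (simp add: assms)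
  then show "matrix_inv A = B"
    by (simp add: matrix_inv_right_left[OF inv] flip: matrix_mul_assoc)
qed

lemma matrix_inv_mult:
  fixes A B :: "'a::field ^ 2 ^ 2"
  assumes "invertible A" "invertible B"
  shows "invertible (A ** B)" "matrix_inv (A ** B) = matrix_inv B ** matrix_inv A"
proof -
  have "(A ** B) ** (matrix_inv B ** matrix_inv A) = A ** (B ** matrix_inv B) ** matrix_inv A"
    by (simp only: matrix_mul_assoc)
  then have 1: "(A ** B) ** (matrix_inv B ** matrix_inv A) = mat 1"
    by (simp add: matrix_inv_right_left assms)
  have "(matrix_inv B ** matrix_inv A) ** (A ** B) = matrix_inv B ** (matrix_inv A ** A) ** B"
    by (simp only: matrix_mul_assoc)
  then have 2: "(matrix_inv B ** matrix_inv A) ** (A ** B) = mat 1"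
    by (simp add: matrix_inv_right_left assms)
  show "invertible (A ** B)" "matrix_inv (A ** B) = matrix_inv B ** matrix_inv A"
    by (rule matrix_inv_eqI[OF 1 2])+
qed

lemma invertible_2x2_iff:
  "invertible (A :: 'a::field ^ 2 ^ 2) \<longleftrightarrow> A $ 1 $ 1 * A $ 2 $ 2 \<noteq> A $ 1 $ 2 * A $ 2 $ 1"
  by (simp add: invertible_det_nz det_2)

lemma mat2_eqI:
  "A = B" if "A $ 1 $ 1 = B $ 1 $ 1" "A $ 1 $ 2 = B $ 1 $ 2" "A $ 2 $ 1 = B $ 2 $ 1" "A $ 2 $ 2 = B $ 2 $ 2"
  for A B :: "'a ^ 2 ^ 2"
  using that by (simp add: vec_eq_iff forall_2)

lemma scalar_mat_commute: "mat c ** A = A ** mat c" for A :: "'a::field ^ 2 ^ 2"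
  by (rule mat2_eqI) (simp_all add: matrix_matrix_mult_def mat_def sum_2)

lemma mat_mult_mat: "mat a ** mat b = (mat (a * b) :: 'a::field ^ 2 ^ 2)"
  by (rule mat2_eqI) (simp_all add: matrix_matrix_mult_def mat_def sum_2)

lemma invertible_mat: "c \<noteq> 0 \<Longrightarrow> invertible (mat c :: 'a::field ^ 2 ^ 2)"
  by (simp add: invertible_2x2_iff mat_def)

lemma matrix_inv_mat: "c \<noteq> 0 \<Longrightarrow> matrix_inv (mat c) = (mat (inverse c) :: 'a::field ^ 2 ^ 2)"
  by (rule matrix_inv_eqI) (simp_all add: mat_mult_mat)

section \<open>Forms\<close>

lemma poly2_eqI: "(\<And>i j. coeff (coeff F j) i = coeff (coeff G j) i) \<Longrightarrow> F = G"
  for F G :: "'a::field poly2"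
  by (intro poly_eqI) blast

lemma coeff2_const2: "coeff (coeff (const2 a) j) i = (if i = 0 \<and> j = 0 then a else 0)"
  by (simp add: const2_def coeff_pCons split: nat.splits)

lemma coeff2_const2_mult: "coeff (coeff (const2 a * F) j) i = a * coeff (coeff F j) i"
  by (simp add: const2_def)

lemma coeff2_var_x_mult:
  "coeff (coeff (var_x * F) j) i = (if i = 0 then 0 else coeff (coeff F j) (i - 1))"
  by (simp add: var_x_def coeff_pCons split: nat.splits)

lemma coeff2_var_y_mult:
  "coeff (coeff (var_y * F) j) i = (if j = 0 then 0 else coeff (coeff F (j - 1)) i)"
  by (simp add: var_y_def coeff_pCons split: nat.splits)

lemma coeff2_comp_mat_scalar:
  "coeff (coeff (comp_mat F (mat t)) j) i = t ^ (i + j) * coeff (coeff F j) i"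
proof (induction F arbitrary: i j rule: poly2_induct)
  case (x F)
  have "comp_mat (var_x * F) (mat t) = const2 t * (var_x * comp_mat F (mat t))"
    by (simp add: mat_def algebra_simps)
  then show ?case
    by (cases i) (simp_all only: coeff2_const2_mult coeff2_var_x_mult x, simp_all)
next
  case (y F)
  have "comp_mat (var_y * F) (mat t) = const2 t * (var_y * comp_mat F (mat t))"
    by (simp add: mat_def algebra_simps)
  then show ?case
    by (cases j) (simp_all only: coeff2_const2_mult coeff2_var_y_mult y, simp_all)
qed (simp_all add: coeff2_const2 algebra_simps)

lemma exists_power_neq:
  assumes "m < n"
  shows "\<exists>t::'a::alg_closed_field. t \<noteq> 0 \<and> t ^ m \<noteq> t ^ n"
proof -
  \<comment> \<open>A root \<open>t\<close> satisfies \<open>t * (t ^ n - t ^ m) = 1\<close>, which settles both requirements.\<close>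
  define g :: "'a poly" where "g = monom 1 (Suc n) - monom 1 (Suc m) - 1"
  have "coeff g (Suc n) = 1"
    using assms by (simp add: g_def)
  then have "degree g > 0"
    using le_degree[of g "Suc n"] by simp
  then obtain t where "poly g t = 0"
    using alg_closed_imp_poly_has_root by blast
  then have "t * (t ^ n - t ^ m) = 1"
    by (simp add: g_def poly_monom algebra_simps)
  then show ?thesis
    by (intro exI[of _ t]) auto
qed

text \<open>Over an infinite field homogeneity is the scaling law \<open>F(tx, ty) = t\<^sup>d F(x, y)\<close>. In this form
  it visibly passes to products, to compositions with matrices, and to cofactors.\<close>

lemma homogeneous_iff_scaling:
  fixes F :: "'a::alg_closed_field poly2"
  shows "homogeneous d F \<longleftrightarrow> (\<forall>t. t \<noteq> 0 \<longrightarrow> comp_mat F (mat t) = const2 (t ^ d) * F)"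
proof
  assume "homogeneous d F"
  then show "\<forall>t. t \<noteq> 0 \<longrightarrow> comp_mat F (mat t) = const2 (t ^ d) * F"
    unfolding homogeneous_def
    by (intro allI impI poly2_eqI) (metis coeff2_comp_mat_scalar coeff2_const2_mult mult_zero_right)
next
  assume *: "\<forall>t. t \<noteq> 0 \<longrightarrow> comp_mat F (mat t) = const2 (t ^ d) * F"
  show "homogeneous d F"
    unfolding homogeneous_def
  proof (intro allI impI, rule ccontr)
    fix i j
    assume nz: "coeff (coeff F j) i \<noteq> 0" and "i + j \<noteq> d"
    then obtain t :: 'a where t: "t \<noteq> 0" "t ^ (i + j) \<noteq> t ^ d"
      using exists_power_neq[of "i + j" d] exists_power_neq[of d "i + j"] by (metis nat_neq_iff)
    have "t ^ (i + j) * coeff (coeff F j) i = t ^ d * coeff (coeff F j) i"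
      using * t(1) by (metis coeff2_comp_mat_scalar coeff2_const2_mult)
    then show False
      using nz t by simp
  qed
qed

lemma homogeneous_add: "homogeneous d F \<Longrightarrow> homogeneous d G \<Longrightarrow> homogeneous d (F + G)"
  unfolding homogeneous_def coeff_add by (metis add.right_neutral)

lemma homogeneous_diff: "homogeneous d F \<Longrightarrow> homogeneous d G \<Longrightarrow> homogeneous d (F - G)"
  unfolding homogeneous_def coeff_diff by (metis diff_self)

lemma homogeneous_const2_mult: "homogeneous d F \<Longrightarrow> homogeneous d (const2 a * F)"
  by (simp add: homogeneous_def coeff2_const2_mult)

lemma homogeneous_var_x_mult: "homogeneous d F \<Longrightarrow> homogeneous (Suc d) (var_x * F)"
  by (simp add: homogeneous_def coeff2_var_x_mult) (metis Suc_pred add_Suc)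

lemma homogeneous_var_y_mult: "homogeneous d F \<Longrightarrow> homogeneous (Suc d) (var_y * F)"
  by (simp add: homogeneous_def coeff2_var_y_mult) (metis Suc_pred add_Suc_right)

lemma homogeneous_var_y: "homogeneous 1 var_y"
  by (auto simp: homogeneous_def var_y_def coeff_pCons split: nat.splits)

lemma homogeneous_comp_mat:
  fixes F :: "'a::alg_closed_field poly2"
  assumes "homogeneous d F"
  shows "homogeneous d (comp_mat F A)"
  using assms unfolding homogeneous_iff_scaling
  by (metis comp_mat_comp_mat comp_mat_simps(2,4) scalar_mat_commute)

lemma homogeneous_cofactor:
  fixes L F :: "'a::alg_closed_field poly2"
  assumes "homogeneous (e + d) (L * F)" "homogeneous e L" "L \<noteq> 0"
  shows "homogeneous d F"
  unfolding homogeneous_iff_scaling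
proof (intro allI impI)
  fix t :: 'a
  assume "t \<noteq> 0"
  then have "const2 (t ^ e) * L * comp_mat F (mat t) = const2 (t ^ (e + d)) * (L * F)"
    using assms(1,2) unfolding homogeneous_iff_scaling by (metis comp_mat_simps(4))
  also have "\<dots> = const2 (t ^ e) * L * (const2 (t ^ d) * F)"
    by (simp add: power_add algebra_simps)
  finally show "comp_mat F (mat t) = const2 (t ^ d) * F"
    using \<open>L \<noteq> 0\<close> \<open>t \<noteq> 0\<close> by (simp del: const2_simps(4) add: mult.assoc)
qed

lemma coeff2_d_dx: "coeff (coeff (d_dx F) j) i = of_nat (Suc i) * coeff (coeff F j) (Suc i)"
  by (simp add: coeff_d_dx coeff_pderiv)

lemma coeff2_d_dy: "coeff (coeff (d_dy F) j) i = of_nat (Suc j) * coeff (coeff F (Suc j)) i"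
  by (simp add: d_dy_def coeff_pderiv of_nat_poly del: of_nat_Suc)

lemma homogeneous_d_dx: "homogeneous d F \<Longrightarrow> homogeneous (d - 1) (d_dx F)"
  unfolding homogeneous_def coeff2_d_dx by (metis add_Suc diff_Suc_1 mult_zero_right)

lemma homogeneous_d_dy: "homogeneous d F \<Longrightarrow> homogeneous (d - 1) (d_dy F)"
  unfolding homogeneous_def coeff2_d_dy by (metis add_Suc_right diff_Suc_1 mult_zero_right)

lemma coeff2_var_x_d_dx: "coeff (coeff (var_x * d_dx F) j) i = of_nat i * coeff (coeff F j) i"
  by (cases i) (simp_all add: coeff2_var_x_mult coeff2_d_dx)

lemma coeff2_var_y_d_dy: "coeff (coeff (var_y * d_dy F) j) i = of_nat j * coeff (coeff F j) i"
  by (cases j) (simp_all add: coeff2_var_y_mult coeff2_d_dy)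

lemma euler_homogeneous:
  assumes "homogeneous d F"
  shows "var_x * d_dx F + var_y * d_dy F = const2 (of_nat d) * F"
proof (rule poly2_eqI)
  fix i j
  have "of_nat i * coeff (coeff F j) i + of_nat j * coeff (coeff F j) i
      = of_nat d * coeff (coeff F j) i"
  proof (cases "coeff (coeff F j) i = 0")
    case False
    then have "i + j = d"
      using assms unfolding homogeneous_def by blast
    then show ?thesis
      by (auto simp flip: distrib_right)
  qed simp
  then show "coeff (coeff (var_x * d_dx F + var_y * d_dy F) j) i
      = coeff (coeff (const2 (of_nat d) * F) j) i"
    by (simp only: coeff_add coeff2_var_x_d_dx coeff2_var_y_d_dy coeff2_const2_mult)
qed

lemma homogeneous_degree_unique:
  "homogeneous d F \<Longrightarrow> homogeneous e F \<Longrightarrow> F \<noteq> 0 \<Longrightarrow> d = e" for F :: "'a::field poly2"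
  unfolding homogeneous_def by (metis poly2_eqI coeff_0)

lemma homogeneous_0_iff: "homogeneous 0 F \<longleftrightarrow> (\<exists>a. F = const2 a)"
proof
  assume "homogeneous 0 F"
  then have "F = const2 (coeff (coeff F 0) 0)"
    by (intro poly2_eqI) (auto simp: homogeneous_def coeff2_const2)
  then show "\<exists>a. F = const2 a" ..
qed (auto simp: homogeneous_def coeff2_const2 split: if_splits)

lemma is_unit_poly2_iff: "is_unit F \<longleftrightarrow> (\<exists>a. a \<noteq> 0 \<and> F = const2 a)" for F :: "'a::field poly2"
proof
  assume "is_unit F"
  then show "\<exists>a. a \<noteq> 0 \<and> F = const2 a"
    by (auto simp: const2_def is_unit_poly_iff)
next
  assume "\<exists>a. a \<noteq> 0 \<and> F = const2 a"
  then obtain a where "a \<noteq> 0" "F = const2 a" by blast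
  then have "1 = F * const2 (inverse a)"
    by (simp flip: const2_simps(4))
  then show "is_unit F"
    by (rule dvdI)
qed

section \<open>Linear factors of forms\<close>

lemma var_y_dvd_iff: "var_y dvd F \<longleftrightarrow> coeff F 0 = 0"
  using poly_eq_0_iff_dvd[of F 0] by (simp add: var_y_def poly_0_coeff_0)

lemma prime_elem_var_y: "prime_elem (var_y :: 'a::field poly2)"
  by (rule prime_elemI) (simp_all add: var_y_dvd_iff coeff_mult_0, simp add: var_y_def)

lemma comp_mat_matrix_inv:
  assumes "invertible S"
  shows "comp_mat (comp_mat F S) (matrix_inv S) = F" "comp_mat (comp_mat F (matrix_inv S)) S = F"
  by (simp_all add: comp_mat_comp_mat matrix_inv_right_left assms)

lemma comp_mat_dvd: "F dvd G \<Longrightarrow> comp_mat F A dvd comp_mat G A"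
  by (auto simp: dvd_def)

lemma comp_mat_dvd_iff:
  assumes "invertible S"
  shows "comp_mat F S dvd G \<longleftrightarrow> F dvd comp_mat G (matrix_inv S)"
  using comp_mat_dvd comp_mat_matrix_inv[OF assms] by metis

lemma comp_mat_eq_0_iff: "invertible S \<Longrightarrow> comp_mat F S = 0 \<longleftrightarrow> F = 0"
  using comp_mat_matrix_inv comp_mat_simps(1) by metis

text \<open>Over an algebraically closed field forms split into linear factors, which replaces unique
  factorization in the ring of bivariate polynomials. A linear form is the coordinate \<open>y\<close> in another
  basis, so it is prime because \<open>y\<close> is.\<close>

definition linear_form :: "'a::field poly2 \<Rightarrow> bool" where
  "linear_form L \<longleftrightarrow> (\<exists>S. invertible S \<and> L = comp_mat var_y S)"

lemma prime_elem_linear_form: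
  assumes "linear_form L"
  shows "prime_elem L"
proof -
  obtain S where S: "invertible S" and L: "L = comp_mat var_y S"
    using assms unfolding linear_form_def by blast
  show ?thesis
  proof (rule prime_elemI)
    show "L \<noteq> 0"
      using comp_mat_eq_0_iff[OF S, of var_y] by (simp add: L var_y_def)
    show "\<not> is_unit L"
      unfolding L comp_mat_dvd_iff[OF S] using prime_elem_var_y[where 'a = 'a] by simp
    show "L dvd F \<or> L dvd G" if "L dvd F * G" for F G
      using that prime_elem_var_y[where 'a = 'a] prime_elem_dvd_mult_iff
      unfolding L comp_mat_dvd_iff[OF S] by force
  qed
qed

lemma homogeneous_linear_form: "linear_form L \<Longrightarrow> homogeneous 1 L"
  for L :: "'a::alg_closed_field poly2"
  unfolding linear_form_def using homogeneous_comp_mat homogeneous_var_y by blast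

definition eval2 :: "'a::field poly2 \<Rightarrow> 'a \<Rightarrow> 'a \<Rightarrow> 'a" where
  "eval2 F a b = poly (poly F [:b:]) a"

lemma eval2_simps [simp]:
  "eval2 (F + G) a b = eval2 F a b + eval2 G a b" "eval2 (F * G) a b = eval2 F a b * eval2 G a b"
  "eval2 (const2 c) a b = c" "eval2 var_x a b = a" "eval2 var_y a b = b"
  by (simp_all add: eval2_def const2_def var_x_def var_y_def)

lemma eval2_comp_mat:
  "eval2 (comp_mat F A) a b = eval2 F (A $ 1 $ 1 * a + A $ 1 $ 2 * b) (A $ 2 $ 1 * a + A $ 2 $ 2 * b)"
  by (induction F rule: poly2_induct)
    (simp_all add: algebra_simps)

lemma coeff_0_homogeneous: "homogeneous d F \<Longrightarrow> coeff F 0 = monom (coeff (coeff F 0) d) d"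
  by (rule poly_eqI) (metis add.right_neutral coeff_monom homogeneous_def)

lemma var_y_dvd_homogeneous_iff:
  assumes "homogeneous d F"
  shows "var_y dvd F \<longleftrightarrow> coeff (coeff F 0) d = 0"
  using coeff_0_homogeneous[OF assms] by (metis monom_eq_0_iff var_y_dvd_iff)

lemma var_y_dvd_iff_eval2:
  assumes "homogeneous d F"
  shows "var_y dvd F \<longleftrightarrow> eval2 F 1 0 = 0"
proof -
  have "eval2 F 1 0 = poly (coeff F 0) 1"
    by (simp add: eval2_def poly_0_coeff_0)
  also have "\<dots> = coeff (coeff F 0) d"
    by (subst coeff_0_homogeneous[OF assms]) (simp add: poly_monom)
  finally show ?thesis
    using var_y_dvd_homogeneous_iff[OF assms] by simp
qed

text \<open>Setting \<open>y = 1\<close> in a form keeps its top coefficients: that of \<open>x\<^sup>i\<close> comes from the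
  monomial \<open>x\<^sup>i y\<^sup>d\<^sup>-\<^sup>i\<close> alone.\<close>

lemma coeff_poly_1_homogeneous:
  assumes "homogeneous d F"
  shows "coeff (poly F 1) i = (if i \<le> d then coeff (coeff F (d - i)) i else 0)"
proof -
  have "coeff (poly F 1) i = (\<Sum>j\<le>degree F. coeff (coeff F j) i)"
    by (simp add: poly_altdef coeff_sum)
  also have "\<dots> = (\<Sum>j\<le>degree F. if j = d - i then if i \<le> d then coeff (coeff F (d - i)) i else 0 else 0)"
  proof (intro sum.cong refl)
    fix j
    show "coeff (coeff F j) i = (if j = d - i then if i \<le> d then coeff (coeff F (d - i)) i else 0 else 0)"
    proof (cases "coeff (coeff F j) i = 0")
      case False
      then have "i + j = d"
        using assms unfolding homogeneous_def by blast
      then show ?thesis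
        by auto
    qed auto
  qed
  \<comment> \<open>If \<open>d - i > degree F\<close> then the sum misses this term, but its value is \<open>0\<close>.\<close>
  also have "\<dots> = (if i \<le> d then coeff (coeff F (d - i)) i else 0)"
    by (auto simp: sum.delta coeff_eq_0)
  finally show ?thesis .
qed

lemma exists_linear_factor:
  fixes F :: "'a::alg_closed_field poly2"
  assumes F: "homogeneous d F" and "d > 0"
  shows "\<exists>L. linear_form L \<and> L dvd F"
proof (cases "var_y dvd F")
  case True
  then show ?thesis
    unfolding linear_form_def
    by (metis comp_mat_mat_1 invertible_mat one_neq_zero)
next
  case False
  then have "coeff (poly F 1) d \<noteq> 0"
    by (simp add: coeff_poly_1_homogeneous[OF F] var_y_dvd_homogeneous_iff[OF F])
  then have "degree (poly F 1) > 0"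
    using \<open>d > 0\<close> le_degree by fastforce
  then obtain r where "poly (poly F 1) r = 0"
    using alg_closed_imp_poly_has_root by blast
  then have r: "eval2 F r 1 = 0"
    by (simp add: eval2_def flip: one_pCons)
  \<comment> \<open>The point \<open>(1, 0)\<close>, where \<open>y\<close> vanishes, goes to the zero \<open>(r, 1)\<close> of \<open>F\<close>.\<close>
  define S :: "'a ^ 2 ^ 2" where "S = vector [vector [r, 1], vector [1, 0]]"
  have S: "invertible S"
    by (simp add: invertible_2x2_iff S_def)
  have "var_y dvd comp_mat F S"
    unfolding var_y_dvd_iff_eval2[OF homogeneous_comp_mat[OF F]] eval2_comp_mat
    by (simp add: S_def r)
  then have "comp_mat var_y (matrix_inv S) dvd F"
    using comp_mat_dvd comp_mat_matrix_inv(1)[OF S] by metis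
  then show ?thesis
    unfolding linear_form_def using invertible_matrix_inv[OF S] by blast
qed

lemma linear_form_cofactor:
  fixes F :: "'a::alg_closed_field poly2"
  assumes "linear_form L" "homogeneous (Suc d) (L * F)"
  shows "homogeneous d F"
  using homogeneous_cofactor[of 1 d L F] homogeneous_linear_form assms prime_elem_linear_form
  by (metis plus_1_eq_Suc prime_elem_not_zeroI)

text \<open>Split off linear factors of \<open>F\<close>: each of them, being prime, divides \<open>R\<close> or its cofactor, and if
  all went into the cofactor then \<open>R\<close> would be a unit. So two forms with a common divisor of any kind
  have a common linear factor.\<close>

lemma linear_factor_of_divisor:
  fixes F :: "'a::alg_closed_field poly2"
  assumes "homogeneous d F" "F \<noteq> 0" "R dvd F" "\<not> is_unit R"
  shows "\<exists>L. linear_form L \<and> L dvd R"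
  using assms
proof (induction d arbitrary: F)
  case 0
  then have "is_unit F"
    by (metis homogeneous_0_iff is_unit_poly2_iff const2_eq_0_iff)
  then show ?case
    using 0 dvd_trans by blast
next
  case (Suc d)
  obtain L where L: "linear_form L" "L dvd F"
    using exists_linear_factor Suc.prems(1) by blast
  obtain F' where F': "F = L * F'"
    using L(2) by (elim dvdE)
  obtain K where K: "F = R * K"
    using Suc.prems(3) by (elim dvdE)
  have L0: "L \<noteq> 0"
    using F' Suc.prems(2) by auto
  consider "L dvd R" | "L dvd K"
    using prime_elem_dvd_mult_iff[OF prime_elem_linear_form[OF L(1)], of R K] K L(2) by auto
  then show ?case
  proof cases
    case 2
    then obtain K' where "K = L * K'" by (elim dvdE)
    then have "L * F' = L * (R * K')"
      using F' K by (metis mult.left_commute)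
    then have "R dvd F'"
      using L0 by simp
    then show ?thesis
      using Suc L F' linear_form_cofactor[OF L(1)] by (metis mult_zero_right)
  qed (use L in blast)
qed

text \<open>Euclid's lemma, by induction on the degree: a linear factor of \<open>P\<close> cannot divide \<open>Q\<close>, so it
  divides \<open>R\<close> and cancels from both sides.\<close>

lemma form_dvd_mult_cancel:
  fixes P Q R :: "'a::alg_closed_field poly2"
  assumes "homogeneous d P" "P \<noteq> 0" "coprime P Q" "P dvd R * Q"
  shows "P dvd R"
  using assms
proof (induction d arbitrary: P R)
  case 0
  then have "is_unit P"
    by (metis homogeneous_0_iff is_unit_poly2_iff const2_eq_0_iff)
  then show ?case
    by (rule unit_imp_dvd)
next
  case (Suc d)
  obtain L where L: "linear_form L" "L dvd P"
    using exists_linear_factor Suc.prems(1) by blast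
  then have prime: "prime_elem L"
    by (intro prime_elem_linear_form)
  obtain P' where P': "P = L * P'"
    using L(2) by (elim dvdE)
  have "\<not> L dvd Q"
    using Suc.prems(3) L(2) prime by (meson coprime_common_divisor prime_elem_not_unit)
  then have "L dvd R"
    using prime_elem_dvd_mult_iff[OF prime] Suc.prems(4) L(2) dvd_trans by blast
  then obtain R' where R': "R = L * R'" by (elim dvdE)
  have L0: "L \<noteq> 0"
    using P' Suc.prems(2) by auto
  have "P' dvd R' * Q"
    using Suc.prems(4) L0 unfolding P' R' mult.assoc by simp
  moreover have "coprime P' Q"
    using Suc.prems(3) P' by (metis coprime_divisors dvd_refl dvd_triv_right)
  ultimately have "P' dvd R'"
    using Suc.IH Suc.prems(1,2) P' linear_form_cofactor[OF L(1)] by (metis mult_zero_right)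
  then show ?case
    by (simp add: P' R')
qed

section \<open>Rational maps and coprime coordinates\<close>

text \<open>From \<open>P Q' = P' Q\<close> the form \<open>P\<close> divides \<open>P'\<close> by Euclid's lemma, and the quotient also takes
  \<open>Q\<close> to \<open>Q'\<close>. If \<open>P = 0\<close>, coprimality makes \<open>Q\<close> a constant.\<close>

lemma proportional_coprime_pair:
  fixes P Q P' Q' :: "'a::alg_closed_field poly2"
  assumes PQ: "coprime P Q" "homogeneous d P" "homogeneous d Q" and eq: "P * Q' = P' * Q"
  shows "\<exists>K. P' = K * P \<and> Q' = K * Q"
proof (cases "P = 0")
  case True
  then have "is_unit Q"
    using PQ(1) by simp
  then obtain K where "Q' = Q * K"
    by (meson dvdE unit_imp_dvd)
  moreover have "P' = 0"
    using eq True \<open>is_unit Q\<close> by auto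
  ultimately show ?thesis
    using True by (metis mult.commute mult_zero_right)
next
  case False
  have "P dvd P' * Q"
    using eq by (metis dvd_triv_left)
  then have "P dvd P'"
    using form_dvd_mult_cancel PQ False by blast
  then obtain K where K: "P' = P * K" by (elim dvdE)
  then have "P * Q' = P * (K * Q)"
    using eq by (simp add: mult.assoc)
  then show ?thesis
    using K False by (metis mult.commute mult_left_cancel)
qed

text \<open>The factor \<open>K\<close> between two coprime pairs divides both entries of one of them, so it is a unit.\<close>

lemma coprime_pair_degree_unique:
  fixes P Q P' Q' :: "'a::alg_closed_field poly2"
  assumes "coprime P Q" "homogeneous d P" "homogeneous d Q"
    and "coprime P' Q'" "homogeneous e P'" "homogeneous e Q'"
    and "P * Q' = P' * Q"
  shows "d = e"
proof -
  obtain K where K: "P' = K * P" "Q' = K * Q"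
    using proportional_coprime_pair assms by meson
  then have "is_unit K"
    using assms(4) by (meson coprime_common_divisor dvd_triv_left)
  then obtain c where c: "c \<noteq> 0" "K = const2 c"
    using is_unit_poly2_iff by blast
  have "homogeneous d P'" "homogeneous d Q'"
    using K c assms(2,3) homogeneous_const2_mult by auto
  moreover have "P' \<noteq> 0 \<or> Q' \<noteq> 0"
    using assms(4) by auto
  ultimately show ?thesis
    using assms(5,6) homogeneous_degree_unique by blast
qed

lemma ratmap_eq_if_mem: "v \<in> form_pairs \<Longrightarrow> (v, w) \<in> form_pairs_rel \<Longrightarrow>
    form_pairs_rel `` {v} = form_pairs_rel `` {w}"
  using equiv_form_pairs_rel equiv_class_eq by metis

lemma ratmap_cases:
  assumes "f \<in> rational_maps" "(P, Q) \<in> f"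
  shows "(P, Q) \<in> form_pairs" "f = ratmap P Q"
proof -
  obtain v where v: "v \<in> form_pairs" "f = form_pairs_rel `` {v}"
    using assms(1) unfolding rational_maps_def by (elim quotientE)
  then have "(v, (P, Q)) \<in> form_pairs_rel"
    using assms(2) by auto
  then show "f = ratmap P Q"
    unfolding ratmap_def v(2) by (rule ratmap_eq_if_mem[OF v(1)])
  show "(P, Q) \<in> form_pairs"
    using \<open>(v, (P, Q)) \<in> form_pairs_rel\<close> by (auto simp: form_pairs_rel_def)
qed

lemma mem_ratmap_iff:
  assumes "(P, Q) \<in> form_pairs"
  shows "(P', Q') \<in> ratmap P Q \<longleftrightarrow> (P', Q') \<in> form_pairs \<and> P * Q' = P' * Q"
  using assms by (auto simp: ratmap_def form_pairs_rel_def)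

text \<open>Coordinates of least degree are coprime, since a common divisor would contain a linear form
  that can be cancelled.\<close>

lemma exists_coprime_coordinates:
  fixes f :: "('a::alg_closed_field poly2 \<times> 'a poly2) set"
  assumes f: "f \<in> rational_maps"
  shows "\<exists>P Q. (P, Q) \<in> f \<and> coprime P Q \<and>
    homogeneous (ratmap_degree f) P \<and> homogeneous (ratmap_degree f) Q"
proof -
  define has_pair where
    "has_pair d \<longleftrightarrow> (\<exists>P Q. (P, Q) \<in> f \<and> homogeneous d P \<and> homogeneous d Q)" for d
  obtain v where "v \<in> f"
    using f equiv_form_pairs_rel unfolding rational_maps_def
    using in_quotient_imp_non_empty by blast
  then obtain P Q where "(P, Q) \<in> f"
    by (cases v) blast
  then have "\<exists>d. has_pair d"
    using ratmap_cases(1)[OF f] unfolding has_pair_def form_pairs_def by blast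
  then obtain d where d: "has_pair d" and least: "\<And>e. has_pair e \<Longrightarrow> d \<le> e"
    by (metis LeastI_ex Least_le)
  then obtain P Q where mem: "(P, Q) \<in> f" and hom: "homogeneous d P" "homogeneous d Q"
    unfolding has_pair_def by blast
  have pair: "(P, Q) \<in> form_pairs" and f_eq: "f = ratmap P Q"
    using ratmap_cases[OF f mem] by auto
  have "coprime P Q"
  proof (rule coprimeI, rule ccontr)
    fix R
    assume R: "R dvd P" "R dvd Q" "\<not> is_unit R"
    have nz: "P \<noteq> 0 \<or> Q \<noteq> 0"
      using pair by (simp add: form_pairs_def)
    then obtain L where L: "linear_form L" "L dvd R"
      using linear_factor_of_divisor[OF hom(1) _ R(1,3)]
        linear_factor_of_divisor[OF hom(2) _ R(2,3)] by metis
    obtain P' where P': "P = L * P'"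
      using dvd_trans[OF L(2) R(1)] by (elim dvdE)
    obtain Q' where Q': "Q = L * Q'"
      using dvd_trans[OF L(2) R(2)] by (elim dvdE)
    have "d \<noteq> 0"
    proof
      assume "d = 0"
      then have "is_unit P \<or> is_unit Q"
        using nz hom by (metis const2_eq_0_iff homogeneous_0_iff is_unit_poly2_iff)
      then have "is_unit L"
        using P' Q' by (metis dvd_mult_unit_iff' dvd_triv_left is_unit_mult_iff)
      then show False
        using prime_elem_linear_form[OF L(1)] prime_elem_not_unit by blast
    qed
    then obtain e where e: "d = Suc e"
      using not0_implies_Suc by blast
    have "homogeneous e P'" "homogeneous e Q'"
      using hom linear_form_cofactor[OF L(1)] unfolding e P' Q' by auto
    moreover from this have "(P', Q') \<in> form_pairs"
      using nz P' Q' by (auto simp: form_pairs_def)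
    then have "(P', Q') \<in> f"
      unfolding f_eq mem_ratmap_iff[OF pair] by (simp add: P' Q' mult_ac)
    ultimately have "has_pair e"
      unfolding has_pair_def by blast
    then show False
      using least e by fastforce
  qed
  have "ratmap_degree f = d"
    unfolding ratmap_degree_def
  proof (rule the_equality)
    show "\<exists>(P, Q)\<in>f. coprime P Q \<and> homogeneous d P \<and> homogeneous d Q"
      using mem hom \<open>coprime P Q\<close> by blast
    show "e = d" if e: "\<exists>(P, Q)\<in>f. coprime P Q \<and> homogeneous e P \<and> homogeneous e Q" for e
    proof -
      obtain P' Q' where *: "(P', Q') \<in> f" "coprime P' Q'" "homogeneous e P'" "homogeneous e Q'"
        using e by auto
      then have "P * Q' = P' * Q"
        by (simp add: f_eq mem_ratmap_iff[OF pair])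
      then show ?thesis
        using coprime_pair_degree_unique[OF \<open>coprime P Q\<close> hom *(2-4)] by simp
    qed
  qed
  then show ?thesis
    using mem hom \<open>coprime P Q\<close> by blast
qed

section \<open>Conjugation as a group action\<close>

lemma conj_pair_eq:
  "conj_pair A (P, Q) =
    (const2 (matrix_inv A $ 1 $ 1) * comp_mat P A + const2 (matrix_inv A $ 1 $ 2) * comp_mat Q A,
     const2 (matrix_inv A $ 2 $ 1) * comp_mat P A + const2 (matrix_inv A $ 2 $ 2) * comp_mat Q A)"
  by (simp add: conj_pair_def Let_def)

text \<open>This is \<open>v \<circ> A = A w\<close> for \<open>w = A\<inverse> v \<circ> A\<close>, which clears the inverse matrix.\<close>

lemma conj_pair_eq_iff:
  assumes "invertible A"
  shows "conj_pair A (P, Q) = (P', Q') \<longleftrightarrow>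
    comp_mat P A = const2 (A $ 1 $ 1) * P' + const2 (A $ 1 $ 2) * Q' \<and>
    comp_mat Q A = const2 (A $ 2 $ 1) * P' + const2 (A $ 2 $ 2) * Q'"
proof -
  have solve: "(B $ 1 $ 1 * A $ 1 $ 1 + B $ 1 $ 2 * A $ 2 $ 1 = 1 \<and>
      B $ 1 $ 1 * A $ 1 $ 2 + B $ 1 $ 2 * A $ 2 $ 2 = 0) \<and>
      B $ 2 $ 1 * A $ 1 $ 1 + B $ 2 $ 2 * A $ 2 $ 1 = 0 \<and>
      B $ 2 $ 1 * A $ 1 $ 2 + B $ 2 $ 2 * A $ 2 $ 2 = 1"
    if "B ** A = mat 1" for A B :: "'a ^ 2 ^ 2"
    using arg_cong[OF that, of "\<lambda>M. (M $ 1 $ 1, M $ 1 $ 2, M $ 2 $ 1, M $ 2 $ 2)"]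
    by (simp add: matrix_matrix_mult_def sum_2 mat_def)
  have lin: "const2 a * (const2 b * F + const2 c * G) + const2 a' * (const2 b' * F + const2 c' * G)
      = const2 (a * b + a' * b') * F + const2 (a * c + a' * c') * G"
    for a b c a' b' c' and F G :: "'a poly2"
    by (simp add: algebra_simps)
  note inv = matrix_inv_right_left[OF assms, THEN solve]
  show ?thesis
  proof
    assume "conj_pair A (P, Q) = (P', Q')"
    then have "P' = const2 (matrix_inv A $ 1 $ 1) * comp_mat P A + const2 (matrix_inv A $ 1 $ 2) * comp_mat Q A"
      "Q' = const2 (matrix_inv A $ 2 $ 1) * comp_mat P A + const2 (matrix_inv A $ 2 $ 2) * comp_mat Q A"
      unfolding conj_pair_eq by auto
    then show "comp_mat P A = const2 (A $ 1 $ 1) * P' + const2 (A $ 1 $ 2) * Q' \<and>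
        comp_mat Q A = const2 (A $ 2 $ 1) * P' + const2 (A $ 2 $ 2) * Q'"
      by (simp only: lin inv, simp)
  next
    assume "comp_mat P A = const2 (A $ 1 $ 1) * P' + const2 (A $ 1 $ 2) * Q' \<and>
        comp_mat Q A = const2 (A $ 2 $ 1) * P' + const2 (A $ 2 $ 2) * Q'"
    then show "conj_pair A (P, Q) = (P', Q')"
      unfolding conj_pair_eq prod.inject by (simp only: lin inv, simp)
  qed
qed

lemma conj_pair_mult:
  assumes "invertible A" "invertible B"
  shows "conj_pair (A ** B) v = conj_pair B (conj_pair A v)"
proof -
  obtain P Q where v: "v = (P, Q)" by (cases v)
  obtain P' Q' where A: "conj_pair A (P, Q) = (P', Q')" by (cases "conj_pair A (P, Q)")
  obtain P'' Q'' where B: "conj_pair B (P', Q') = (P'', Q'')" by (cases "conj_pair B (P', Q')")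
  have A': "comp_mat P A = const2 (A $ 1 $ 1) * P' + const2 (A $ 1 $ 2) * Q'"
    "comp_mat Q A = const2 (A $ 2 $ 1) * P' + const2 (A $ 2 $ 2) * Q'"
    using A conj_pair_eq_iff[OF assms(1)] by auto
  have B': "comp_mat P' B = const2 (B $ 1 $ 1) * P'' + const2 (B $ 1 $ 2) * Q''"
    "comp_mat Q' B = const2 (B $ 2 $ 1) * P'' + const2 (B $ 2 $ 2) * Q''"
    using B conj_pair_eq_iff[OF assms(2)] by auto
  have "conj_pair (A ** B) (P, Q) = (P'', Q'')"
    unfolding conj_pair_eq_iff[OF matrix_inv_mult(1)[OF assms]] comp_mat_comp_mat[symmetric] A'
    by (simp add: B' matrix_matrix_mult_def sum_2 algebra_simps)
  then show ?thesis
    by (simp add: v A B)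
qed

lemma conj_pair_mat_1 [simp]: "conj_pair (mat 1) v = v"
proof (cases v)
  case (Pair P Q)
  have "conj_pair (mat 1) (P, Q) = (P, Q)"
    unfolding conj_pair_eq_iff[OF invertible_mat[OF one_neq_zero]] comp_mat_mat_1
    by (simp add: mat_def)
  then show ?thesis
    by (simp add: Pair)
qed

lemma conj_pair_const2_mult:
  "conj_pair A (const2 c * P, const2 c * Q) =
    (const2 c * fst (conj_pair A (P, Q)), const2 c * snd (conj_pair A (P, Q)))"
  by (simp add: conj_pair_eq algebra_simps)

lemma conj_pair_homogeneous:
  fixes P Q :: "'a::alg_closed_field poly2"
  assumes "homogeneous d P" "homogeneous d Q" "conj_pair A (P, Q) = (P', Q')"
  shows "homogeneous d P'" "homogeneous d Q'"
  using assms by (auto simp: conj_pair_eq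
      intro!: homogeneous_add homogeneous_const2_mult homogeneous_comp_mat)

lemma conj_pair_form_pairs:
  fixes v :: "'a::alg_closed_field poly2 \<times> 'a poly2"
  assumes "invertible A" "v \<in> form_pairs"
  shows "conj_pair A v \<in> form_pairs"
proof -
  obtain P Q where v: "v = (P, Q)" by (cases v)
  obtain P' Q' where *: "conj_pair A (P, Q) = (P', Q')" by (cases "conj_pair A (P, Q)")
  obtain d where d: "homogeneous d P" "homogeneous d Q" and nz: "P \<noteq> 0 \<or> Q \<noteq> 0"
    using assms(2) by (auto simp: v form_pairs_def)
  have "P' \<noteq> 0 \<or> Q' \<noteq> 0"
    using * nz comp_mat_eq_0_iff[OF assms(1)] unfolding conj_pair_eq_iff[OF assms(1)]
    by (metis add_0 mult_zero_right)
  then show ?thesis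
    using conj_pair_homogeneous[OF d *] by (auto simp: v * form_pairs_def)
qed

lemma conj_pair_form_pairs_rel:
  fixes v w :: "'a::alg_closed_field poly2 \<times> 'a poly2"
  assumes "invertible A" "(v, w) \<in> form_pairs_rel"
  shows "(conj_pair A v, conj_pair A w) \<in> form_pairs_rel"
proof -
  obtain P Q P' Q' where vw: "v = (P, Q)" "w = (P', Q')" by (cases v, cases w)
  have mem: "v \<in> form_pairs" "w \<in> form_pairs" and eq: "P * Q' = P' * Q"
    using assms(2) by (auto simp: vw form_pairs_rel_def)
  have det: "(a * r + b * s) * (c * r' + d * s') - (a * r' + b * s') * (c * r + d * s)
      = (a * d - b * c) * (r * s' - r' * s)" for a b c d r s r' s' :: "'a poly2"
    by (simp add: algebra_simps)
  have "comp_mat P A * comp_mat Q' A = comp_mat P' A * comp_mat Q A"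
    using eq by (simp flip: comp_mat_simps(4))
  then have "fst (conj_pair A v) * snd (conj_pair A w) = fst (conj_pair A w) * snd (conj_pair A v)"
    unfolding vw conj_pair_eq fst_conv snd_conv
    by (subst right_minus_eq[symmetric], subst det) simp
  then show ?thesis
    using mem[THEN conj_pair_form_pairs[OF assms(1)]]
    by (cases "conj_pair A v"; cases "conj_pair A w") (auto simp: form_pairs_rel_def)
qed

lemma conj_pair_mat_rel:
  fixes v :: "'a::alg_closed_field poly2 \<times> 'a poly2"
  assumes "c \<noteq> 0" "v \<in> form_pairs"
  shows "(conj_pair (mat c) v, v) \<in> form_pairs_rel"
proof -
  obtain P Q where v: "v = (P, Q)" by (cases v)
  obtain d where d: "homogeneous d P" "homogeneous d Q"
    using assms(2) by (auto simp: v form_pairs_def)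
  have "comp_mat P (mat c) = const2 (c ^ d) * P" "comp_mat Q (mat c) = const2 (c ^ d) * Q"
    using d assms(1) homogeneous_iff_scaling by blast+
  then have "fst (conj_pair (mat c) v) * Q = P * snd (conj_pair (mat c) v)"
    by (simp add: v conj_pair_eq matrix_inv_mat[OF assms(1)]) (simp add: mat_def)
  then show ?thesis
    using conj_pair_form_pairs[OF invertible_mat[OF assms(1)] assms(2)] assms(2)
    by (cases "conj_pair (mat c) v") (auto simp: v form_pairs_rel_def)
qed

lemma proj_eq: "proj A = {mat c ** A |c. c \<noteq> 0}"
  by (auto simp: proj_def r_coset_def GL2_def scalars_def)

lemma PGL2_UNIV_carrier: "carrier (PGL2 UNIV) = proj ` {A. invertible A}"
  by (simp add: PGL2_def GL2_def matrices_over_def)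

lemma form_pairs_rel_sym: "(v, w) \<in> form_pairs_rel \<Longrightarrow> (w, v) \<in> form_pairs_rel"
  using equiv_form_pairs_rel by (meson equivE symE)

lemma form_pairs_rel_trans:
  "(u, v) \<in> form_pairs_rel \<Longrightarrow> (v, w) \<in> form_pairs_rel \<Longrightarrow> (u, w) \<in> form_pairs_rel"
  using equiv_form_pairs_rel by (meson equivE transE)

text \<open>A class is preserved by every matrix in a coset as soon as one matrix moves one of its pairs
  within the class; surjectivity comes from the inverse matrix.\<close>

lemma proj_in_Aut:
  fixes P Q :: "'a::alg_closed_field poly2"
  assumes A: "invertible A" and PQ: "(P, Q) \<in> form_pairs"
    and stable: "(conj_pair A (P, Q), (P, Q)) \<in> form_pairs_rel"
  shows "proj A \<in> Aut (ratmap P Q)"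
proof -
  let ?v = "(P, Q)"
  have class_iff: "w \<in> ratmap P Q \<longleftrightarrow> (w, ?v) \<in> form_pairs_rel" for w
    unfolding ratmap_def using form_pairs_rel_sym by blast
  have stable_class: "conj_pair B w \<in> ratmap P Q"
    if B: "invertible B" "(conj_pair B ?v, ?v) \<in> form_pairs_rel" and w: "w \<in> ratmap P Q" for B w
    using conj_pair_form_pairs_rel[OF B(1)] B(2) w form_pairs_rel_trans unfolding class_iff by blast
  have "ratmap_conj (ratmap P Q) (proj A) \<subseteq> ratmap P Q"
  proof
    fix w
    assume "w \<in> ratmap_conj (ratmap P Q) (proj A)"
    then obtain c u where c: "c \<noteq> 0" and u: "u \<in> ratmap P Q" and w: "w = conj_pair (mat c ** A) u"
      by (auto simp: ratmap_conj_def proj_eq)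
    have "conj_pair (mat c) u \<in> ratmap P Q"
      using stable_class[OF invertible_mat conj_pair_mat_rel[OF _ PQ]] c u by blast
    then show "w \<in> ratmap P Q"
      unfolding w conj_pair_mult[OF invertible_mat[OF c] A] by (rule stable_class[OF A stable])
  qed
  moreover have "ratmap P Q \<subseteq> ratmap_conj (ratmap P Q) (proj A)"
  proof
    fix w
    assume w: "w \<in> ratmap P Q"
    have cancel: "conj_pair (matrix_inv A) (conj_pair A u) = u" "conj_pair A (conj_pair (matrix_inv A) u) = u" for u
      by (simp_all add: A invertible_matrix_inv matrix_inv_right_left flip: conj_pair_mult)
    have "(conj_pair (matrix_inv A) ?v, ?v) \<in> form_pairs_rel"
      using conj_pair_form_pairs_rel[OF invertible_matrix_inv[OF A] stable] cancel(1)
        form_pairs_rel_sym by metis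
    then have "conj_pair (matrix_inv A) w \<in> ratmap P Q"
      using stable_class invertible_matrix_inv[OF A] w by blast
    then have "w \<in> conj_pair A ` ratmap P Q"
      using cancel(2)[of w] by (metis image_eqI)
    moreover have "A \<in> proj A"
      unfolding proj_eq by (auto intro!: exI[of _ 1])
    ultimately show "w \<in> ratmap_conj (ratmap P Q) (proj A)"
      unfolding ratmap_conj_def by (rule UN_I[rotated])
  qed
  moreover have "proj A \<in> carrier (PGL2 UNIV)"
    using A by (simp add: PGL2_UNIV_carrier)
  ultimately show ?thesis
    by (simp add: Aut_def)
qed

text \<open>An automorphism multiplies coprime coordinates by a constant: it produces coordinates of the
  same map in the same degree.\<close>

lemma conj_pair_eigenvalue:
  fixes P Q :: "'a::alg_closed_field poly2"
  assumes f: "f \<in> rational_maps" "(P, Q) \<in> f" and PQ: "coprime P Q" "homogeneous d P" "homogeneous d Q"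
    and A: "invertible A" "A \<in> \<alpha>" "\<alpha> \<in> Aut f"
  shows "\<exists>c. c \<noteq> 0 \<and> conj_pair A (P, Q) = (const2 c * P, const2 c * Q)"
proof -
  obtain P' Q' where *: "conj_pair A (P, Q) = (P', Q')" by (cases "conj_pair A (P, Q)")
  have pair: "(P, Q) \<in> form_pairs" and f_eq: "f = ratmap P Q"
    using ratmap_cases[OF f] by auto
  have "(P', Q') \<in> ratmap_conj f \<alpha>"
    unfolding ratmap_conj_def by (rule UN_I[OF A(2)], rule image_eqI[OF _ f(2)]) (simp add: *)
  then have "(P', Q') \<in> f"
    using A(3) by (simp add: Aut_def)
  then have pair': "(P', Q') \<in> form_pairs" and eq: "P * Q' = P' * Q"
    by (auto simp: f_eq mem_ratmap_iff[OF pair])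
  obtain K where K: "P' = K * P" "Q' = K * Q"
    using proportional_coprime_pair[OF PQ eq] by blast
  have "homogeneous 0 K"
    using conj_pair_homogeneous[OF PQ(2,3) *] pair PQ(2,3) homogeneous_cofactor[of d 0 _ K] K
    by (auto simp: form_pairs_def mult.commute)
  then obtain c where "K = const2 c"
    using homogeneous_0_iff by blast
  moreover have "c \<noteq> 0"
    using pair' K \<open>K = const2 c\<close> by (auto simp: form_pairs_def)
  ultimately show ?thesis
    using * K by blast
qed

section \<open>Vector fields and their invariants\<close>

text \<open>The chain rule gives \<open>\<nabla>(G \<circ> A) = A\<^sup>T (\<nabla>G \<circ> A)\<close>, and for \<open>det A = 1\<close> the rotated
  gradient \<open>(G\<^sub>y, - G\<^sub>x)\<close> is therefore transformed by \<open>A\<close>, just as \<open>(x, y)\<close> is.\<close>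

lemma conj_pair_of_invariants:
  assumes det: "det A = 1"
    and F: "comp_mat F A = const2 c * F" and G: "comp_mat G A = const2 c * G"
  shows "conj_pair A (var_x * F + d_dy G, var_y * F - d_dx G) =
    (const2 c * (var_x * F + d_dy G), const2 c * (var_y * F - d_dx G))"
proof -
  define X where "X = comp_mat (d_dx G) A"
  define Y where "Y = comp_mat (d_dy G) A"
  define a11 where "a11 = const2 (A $ 1 $ 1)"
  define a12 where "a12 = const2 (A $ 1 $ 2)"
  define a21 where "a21 = const2 (A $ 2 $ 1)"
  define a22 where "a22 = const2 (A $ 2 $ 2)"
  note entries = a11_def[symmetric] a12_def[symmetric] a21_def[symmetric] a22_def[symmetric]
  have "const2 (det A) = 1"
    by (simp add: det)
  then have det': "a11 * a22 - a12 * a21 = 1"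
    by (simp add: det_2 a11_def a12_def a21_def a22_def)
  have 1: "const2 c * d_dx G = a11 * X + a21 * Y"
    using d_dx_comp_mat[of G A] by (simp add: G X_def Y_def entries)
  have 2: "const2 c * d_dy G = a12 * X + a22 * Y"
    using d_dy_comp_mat[of G A] by (simp add: G X_def Y_def entries)
  have "a11 * (const2 c * d_dy G) - a12 * (const2 c * d_dx G) = (a11 * a22 - a12 * a21) * Y"
    unfolding 1 2 by (simp add: algebra_simps)
  then have Y: "Y = a11 * (const2 c * d_dy G) - a12 * (const2 c * d_dx G)"
    by (simp add: det')
  have "a22 * (const2 c * d_dx G) - a21 * (const2 c * d_dy G) = (a11 * a22 - a12 * a21) * X"
    unfolding 1 2 by (simp add: algebra_simps)
  then have X: "X = a22 * (const2 c * d_dx G) - a21 * (const2 c * d_dy G)"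
    by (simp add: det')
  have inv: "invertible A"
    by (simp add: invertible_det_nz det)
  show ?thesis
    unfolding conj_pair_eq_iff[OF inv] comp_mat_simps comp_mat_diff F X_def[symmetric] Y_def[symmetric]
      entries
    unfolding X Y by (simp add: algebra_simps)
qed

text \<open>Conversely an equivariant pair \<open>(P, Q)\<close> yields two invariants: its determinant with the
  equivariant pair \<open>(x, y)\<close>, and its divergence.\<close>

lemma comp_mat_determinant:
  assumes det: "det A = 1" and PQ: "conj_pair A (P, Q) = (const2 c * P, const2 c * Q)"
  shows "comp_mat (var_y * P - var_x * Q) A = const2 c * (var_y * P - var_x * Q)"
proof -
  have inv: "invertible A"
    by (simp add: invertible_det_nz det)
  have "const2 (det A) = 1"
    by (simp add: det)
  then have det': "const2 (A $ 1 $ 1) * const2 (A $ 2 $ 2) = 1 + const2 (A $ 1 $ 2) * const2 (A $ 2 $ 1)"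
    by (simp add: det_2 algebra_simps)
  have "comp_mat (var_y * P - var_x * Q) A =
      (const2 (A $ 1 $ 1) * const2 (A $ 2 $ 2) - const2 (A $ 1 $ 2) * const2 (A $ 2 $ 1)) *
        (const2 c * (var_y * P - var_x * Q))"
    using PQ unfolding conj_pair_eq_iff[OF inv] by (simp add: algebra_simps)
  then show ?thesis
    by (simp add: det')
qed

lemma comp_mat_divergence:
  assumes det: "det A = 1" and PQ: "conj_pair A (P, Q) = (const2 c * P, const2 c * Q)"
  shows "comp_mat (d_dx P + d_dy Q) A = const2 c * (d_dx P + d_dy Q)"
proof -
  define a11 where "a11 = const2 (A $ 1 $ 1)"
  define a12 where "a12 = const2 (A $ 1 $ 2)"
  define a21 where "a21 = const2 (A $ 2 $ 1)"
  define a22 where "a22 = const2 (A $ 2 $ 2)"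
  note entries = a11_def[symmetric] a12_def[symmetric] a21_def[symmetric] a22_def[symmetric]
  have inv: "invertible A"
    by (simp add: invertible_det_nz det)
  have "const2 (det A) = 1"
    by (simp add: det)
  then have det': "a11 * a22 - a12 * a21 = 1"
    by (simp add: det_2 a11_def a12_def a21_def a22_def)
  have P: "comp_mat P A = const2 (A $ 1 $ 1) * (const2 c * P) + const2 (A $ 1 $ 2) * (const2 c * Q)"
    and Q: "comp_mat Q A = const2 (A $ 2 $ 1) * (const2 c * P) + const2 (A $ 2 $ 2) * (const2 c * Q)"
    using PQ unfolding conj_pair_eq_iff[OF inv] by blast+
  define Px Py Qx Qy where "Px = comp_mat (d_dx P) A" "Py = comp_mat (d_dy P) A"
    "Qx = comp_mat (d_dx Q) A" "Qy = comp_mat (d_dy Q) A"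
  note derivs = Px_Py_Qx_Qy_def[symmetric]
  have 1: "a11 * Px + a21 * Py = const2 c * (a11 * d_dx P + a12 * d_dx Q)"
    using d_dx_comp_mat[of P A] unfolding P d_dx_simps
    unfolding derivs entries by (simp add: algebra_simps)
  have 2: "a12 * Px + a22 * Py = const2 c * (a11 * d_dy P + a12 * d_dy Q)"
    using d_dy_comp_mat[of P A] unfolding P d_dy_simps
    unfolding derivs entries by (simp add: algebra_simps)
  have 3: "a11 * Qx + a21 * Qy = const2 c * (a21 * d_dx P + a22 * d_dx Q)"
    using d_dx_comp_mat[of Q A] unfolding Q d_dx_simps
    unfolding derivs entries by (simp add: algebra_simps)
  have 4: "a12 * Qx + a22 * Qy = const2 c * (a21 * d_dy P + a22 * d_dy Q)"
    using d_dy_comp_mat[of Q A] unfolding Q d_dy_simps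
    unfolding derivs entries by (simp add: algebra_simps)
  have "a22 * (a11 * Px + a21 * Py) - a21 * (a12 * Px + a22 * Py)
      + a11 * (a12 * Qx + a22 * Qy) - a12 * (a11 * Qx + a21 * Qy)
      = (a11 * a22 - a12 * a21) * (Px + Qy)"
    by (simp add: algebra_simps)
  then have "Px + Qy = a22 * (a11 * Px + a21 * Py) - a21 * (a12 * Px + a22 * Py)
      + a11 * (a12 * Qx + a22 * Qy) - a12 * (a11 * Qx + a21 * Qy)"
    by (simp add: det')
  also have "\<dots> = (a11 * a22 - a12 * a21) * (const2 c * (d_dx P + d_dy Q))"
    unfolding 1 2 3 4 by (simp add: algebra_simps)
  finally show ?thesis
    by (simp add: det' derivs)
qed

text \<open>By Euler's identity the two invariants recover the pair, up to the factor \<open>d + 1\<close>.\<close>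

lemma pair_from_determinant_divergence:
  assumes "homogeneous d P" "homogeneous d Q" "k * of_nat (d + 1) = 1"
  defines "F \<equiv> const2 k * (d_dx P + d_dy Q)" and "G \<equiv> const2 k * (var_y * P - var_x * Q)"
  shows "var_x * F + d_dy G = P" "var_y * F - d_dx G = Q"
proof -
  have unit: "const2 k * (R + const2 (of_nat d) * R) = R" for R
  proof -
    have "R + const2 (of_nat d) * R = const2 (of_nat (d + 1)) * R"
      by (simp add: algebra_simps)
    then have "const2 k * (R + const2 (of_nat d) * R) = const2 (k * of_nat (d + 1)) * R"
      by (simp only: const2_simps(4) mult.assoc)
    then show ?thesis
      by (simp only: assms(3) const2_simps(2) mult_1_left)
  qed
  have "var_x * F + d_dy G = const2 k * (P + (var_x * d_dx P + var_y * d_dy P))"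
    by (simp add: F_def G_def) (simp add: algebra_simps)
  then show "var_x * F + d_dy G = P"
    by (simp only: euler_homogeneous[OF assms(1)] unit)
  have "var_y * F - d_dx G = const2 k * (Q + (var_x * d_dx Q + var_y * d_dy Q))"
    by (simp add: F_def G_def) (simp add: algebra_simps)
  then show "var_y * F - d_dx G = Q"
    by (simp only: euler_homogeneous[OF assms(2)] unit)
qed

section \<open>Elements of order p\<close>

lemma group_GL2: "group (GL2 :: ('a::field ^ 2 ^ 2) monoid)"
proof (rule groupI)
  fix A :: "'a ^ 2 ^ 2"
  assume "A \<in> carrier GL2"
  then show "\<exists>B\<in>carrier GL2. B \<otimes>\<^bsub>GL2\<^esub> A = \<one>\<^bsub>GL2\<^esub>"
    using invertible_matrix_inv matrix_inv_right_left(2) by (auto simp: GL2_def)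
qed (auto simp: GL2_def matrix_inv_mult invertible_mat matrix_mul_assoc)

lemma normal_scalars: "(scalars :: ('a::field ^ 2 ^ 2) set) \<lhd> GL2"
proof (rule group.normalI[OF group_GL2])
  show "subgroup scalars (GL2 :: ('a ^ 2 ^ 2) monoid)"
  proof (rule group.subgroupI[OF group_GL2])
    fix A :: "'a ^ 2 ^ 2"
    assume "A \<in> scalars"
    then obtain c where c: "c \<noteq> 0" "A = mat c"
      by (auto simp: scalars_def)
    have "inv\<^bsub>GL2\<^esub> A = mat (inverse c)"
      using c by (intro group.inv_equality[OF group_GL2]) (simp_all add: GL2_def mat_mult_mat invertible_mat)
    then show "inv\<^bsub>GL2\<^esub> A \<in> scalars"
      using c by (auto simp: scalars_def)
  next
    fix A B :: "'a ^ 2 ^ 2"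
    assume "A \<in> scalars" "B \<in> scalars"
    then obtain a b where "a \<noteq> 0" "A = mat a" "b \<noteq> 0" "B = mat b"
      by (auto simp: scalars_def)
    then show "A \<otimes>\<^bsub>GL2\<^esub> B \<in> scalars"
      by (auto simp: GL2_def scalars_def mat_mult_mat intro!: exI[of _ "a * b"])
  next
    have "mat 1 \<in> (scalars :: ('a ^ 2 ^ 2) set)"
      unfolding scalars_def by (intro CollectI exI[of _ 1]) simp
    then show "(scalars :: ('a ^ 2 ^ 2) set) \<noteq> {}"
      by blast
  qed (auto simp: scalars_def GL2_def invertible_mat)
  show "\<forall>A\<in>carrier GL2. scalars #>\<^bsub>GL2\<^esub> A = A <#\<^bsub>GL2\<^esub> (scalars :: ('a ^ 2 ^ 2) set)"
    unfolding r_coset_def l_coset_def by (auto simp: GL2_def scalars_def scalar_mat_commute)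
qed

lemma PGL2_UNIV_eq: "PGL2 UNIV = GL2 Mod (scalars :: ('a::field ^ 2 ^ 2) set)"
  by (auto simp: PGL2_def FactGroup_def RCOSETS_def proj_def matrices_over_def)

lemma group_PGL2_UNIV: "group (PGL2 (UNIV :: 'a::field set))"
  unfolding PGL2_UNIV_eq by (rule normal.factorgroup_is_group[OF normal_scalars])

lemma proj_pow:
  assumes "invertible A"
  shows "proj A [^]\<^bsub>PGL2 UNIV\<^esub> (n::nat) = proj (A [^]\<^bsub>GL2\<^esub> n) \<and> invertible (A [^]\<^bsub>GL2\<^esub> n)"
proof (induction n)
  case 0
  have "mat 1 = \<one>\<^bsub>GL2\<^esub>"
    by (simp add: GL2_def)
  then show ?case
    by (auto simp: PGL2_UNIV_eq FactGroup_def proj_eq scalars_def GL2_def invertible_mat)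
next
  case (Suc n)
  have "proj (A [^]\<^bsub>GL2\<^esub> n) \<otimes>\<^bsub>PGL2 UNIV\<^esub> proj A = proj (A [^]\<^bsub>GL2\<^esub> n \<otimes>\<^bsub>GL2\<^esub> A)"
    using normal.rcos_sum[OF normal_scalars, of "A [^]\<^bsub>GL2\<^esub> n" A] Suc assms
    by (simp add: PGL2_UNIV_eq FactGroup_def proj_def GL2_def)
  then show ?case
    using Suc assms by (simp add: GL2_def matrix_inv_mult)
qed

text \<open>Sylow's theorem with exponent \<open>1\<close> provides a subgroup of order exactly \<open>p\<close>.\<close>

lemma cauchy_group:
  assumes "group G" "finite (carrier G)" "prime p" "p dvd Coset.order G"
  shows "\<exists>x\<in>carrier G. x \<noteq> \<one>\<^bsub>G\<^esub> \<and> x [^]\<^bsub>G\<^esub> p = \<one>\<^bsub>G\<^esub>"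
proof -
  interpret group G by fact
  obtain m where "Coset.order G = p ^ 1 * m"
    using assms(4) by (auto elim: dvdE)
  then obtain H where H: "subgroup H G" "card H = p"
    using sylow_thm[OF assms(3,1) _ assms(2)] by fastforce
  then have "\<not> H \<subseteq> {\<one>\<^bsub>G\<^esub>}"
    using prime_gt_1_nat[OF assms(3)] card_mono[of "{\<one>\<^bsub>G\<^esub>}" H] by auto
  then obtain x where x: "x \<in> H" "x \<noteq> \<one>\<^bsub>G\<^esub>" by blast
  interpret H: group "G\<lparr>carrier := H\<rparr>"
    using H(1) by (rule subgroup_imp_group)
  have "x [^]\<^bsub>G\<lparr>carrier := H\<rparr>\<^esub> p = \<one>\<^bsub>G\<^esub>"
    using H.pow_order_eq_1[of x] x(1) H(2) by (simp add: Coset.order_def)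
  then have "x [^]\<^bsub>G\<^esub> p = \<one>\<^bsub>G\<^esub>"
    by (simp add: nat_pow_consistent[symmetric])
  then show ?thesis
    using x subgroup.subset[OF H(1)] by blast
qed

definition upper :: "'a::field \<Rightarrow> 'a \<Rightarrow> 'a ^ 2 ^ 2" where
  "upper b m = vector [vector [1, b], vector [0, m]]"

lemma upper_entries [simp]:
  "upper b m $ 1 $ 1 = 1" "upper b m $ 1 $ 2 = b" "upper b m $ 2 $ 1 = 0" "upper b m $ 2 $ 2 = m"
  by (simp_all add: upper_def)

lemma upper_mult: "upper b m ** upper b' m' = upper (b' + b * m') (m * m')"
  by (rule mat2_eqI) (simp_all add: matrix_matrix_mult_def sum_2)

lemma exists_eigenvector:
  fixes A :: "'a::alg_closed_field ^ 2 ^ 2"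
  assumes "invertible A"
  shows "\<exists>l w1 w2. l \<noteq> 0 \<and> (w1 \<noteq> 0 \<or> w2 \<noteq> 0) \<and>
    A $ 1 $ 1 * w1 + A $ 1 $ 2 * w2 = l * w1 \<and> A $ 2 $ 1 * w1 + A $ 2 $ 2 * w2 = l * w2"
proof -
  let ?D = "A $ 1 $ 1 * A $ 2 $ 2 - A $ 1 $ 2 * A $ 2 $ 1"
  obtain l where "poly [:?D, - (A $ 1 $ 1 + A $ 2 $ 2), 1:] l = 0"
    using alg_closed_imp_poly_has_root[of "[:?D, - (A $ 1 $ 1 + A $ 2 $ 2), 1:]"] by auto
  then have l: "(A $ 1 $ 1 - l) * (A $ 2 $ 2 - l) = A $ 1 $ 2 * A $ 2 $ 1"
    by (simp add: algebra_simps)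
  have "l \<noteq> 0"
    using l assms by (auto simp: invertible_2x2_iff)
  \<comment> \<open>A nonzero row of the singular matrix \<open>A - l\<close>, rotated, spans its kernel.\<close>
  consider "A $ 1 $ 1 - l \<noteq> 0 \<or> A $ 1 $ 2 \<noteq> 0" | "A $ 2 $ 1 \<noteq> 0 \<or> A $ 2 $ 2 - l \<noteq> 0"
    | "A $ 1 $ 1 = l" "A $ 1 $ 2 = 0" "A $ 2 $ 1 = 0" "A $ 2 $ 2 = l"
    by auto
  then show ?thesis
  proof cases
    case 1
    have "A $ 2 $ 1 * A $ 1 $ 2 + A $ 2 $ 2 * (l - A $ 1 $ 1) = l * (l - A $ 1 $ 1)"
      using l by (simp add: algebra_simps)
    then show ?thesis
      using 1 \<open>l \<noteq> 0\<close>
      by (intro exI[of _ l] exI[of _ "A $ 1 $ 2"] exI[of _ "l - A $ 1 $ 1"]) (auto simp: algebra_simps)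
  next
    case 2
    have "A $ 1 $ 1 * (l - A $ 2 $ 2) + A $ 1 $ 2 * A $ 2 $ 1 = l * (l - A $ 2 $ 2)"
      using l by (simp add: algebra_simps)
    then show ?thesis
      using 2 \<open>l \<noteq> 0\<close>
      by (intro exI[of _ l] exI[of _ "l - A $ 2 $ 2"] exI[of _ "A $ 2 $ 1"]) (auto simp: algebra_simps)
  next
    case 3
    then show ?thesis
      using \<open>l \<noteq> 0\<close> by (intro exI[of _ l] exI[of _ 1] exI[of _ 0]) auto
  qed
qed

text \<open>A coset modulo scalars contains a matrix with eigenvalue \<open>1\<close>: divide by any eigenvalue. An
  eigenvector is then the first vector of the triangularizing basis.\<close>

lemma projective_triangularization:
  fixes A :: "'a::alg_closed_field ^ 2 ^ 2"
  assumes "invertible A"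
  shows "\<exists>c S b m. c \<noteq> 0 \<and> invertible S \<and> (mat c ** A) ** S = S ** upper b m"
proof -
  obtain l w1 w2 where l: "l \<noteq> 0" and w: "w1 \<noteq> 0 \<or> w2 \<noteq> 0"
    and eig: "A $ 1 $ 1 * w1 + A $ 1 $ 2 * w2 = l * w1" "A $ 2 $ 1 * w1 + A $ 2 $ 2 * w2 = l * w2"
    using exists_eigenvector[OF assms] by blast
  define S :: "'a ^ 2 ^ 2" where
    "S = vector [vector [w1, if w1 = 0 then 1 else 0], vector [w2, if w1 = 0 then 0 else 1]]"
  have S: "invertible S"
    using w by (auto simp: invertible_2x2_iff S_def)
  define A' where "A' = mat (inverse l) ** A"
  have entry: "(B ** C) $ i $ j = B $ i $ 1 * C $ 1 $ j + B $ i $ 2 * C $ 2 $ j"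
    for B C :: "'a ^ 2 ^ 2" and i j
    by (simp add: matrix_matrix_mult_def sum_2)
  have A'_entry: "A' $ i $ j = inverse l * A $ i $ j" for i j
    using exhaust_2[of i] by (auto simp: A'_def entry mat_def)
  define T where "T = matrix_inv S ** (A' ** S)"
  have "A' ** S = S ** T"
    by (simp add: T_def matrix_mul_assoc matrix_inv_right_left[OF S])
  have "(A' ** S) $ 1 $ 1 = inverse l * (A $ 1 $ 1 * w1 + A $ 1 $ 2 * w2)"
    "(A' ** S) $ 2 $ 1 = inverse l * (A $ 2 $ 1 * w1 + A $ 2 $ 2 * w2)"
    by (simp_all add: entry[of A'] A'_entry S_def algebra_simps)
  then have col: "(A' ** S) $ 1 $ 1 = S $ 1 $ 1" "(A' ** S) $ 2 $ 1 = S $ 2 $ 1"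
    unfolding eig using l by (simp_all add: S_def)
  have "T $ i $ 1 = (matrix_inv S ** S) $ i $ 1" for i
    unfolding T_def entry[of "matrix_inv S"] col by simp
  then have "T $ 1 $ 1 = 1" "T $ 2 $ 1 = 0"
    by (simp_all add: matrix_inv_right_left[OF S] mat_def)
  then have "T = upper (T $ 1 $ 2) (T $ 2 $ 2)"
    by (intro mat2_eqI) simp_all
  then show ?thesis
    using \<open>A' ** S = S ** T\<close> S l unfolding A'_def by (metis nonzero_imp_inverse_nonzero)
qed

text \<open>In triangular form an element of order \<open>p\<close> has diagonal entries \<open>1\<close> and \<open>m\<close> with
  \<open>m\<^sup>p = 1\<close>. In characteristic \<open>p\<close> this forces \<open>m = 1\<close>, and the element is a translation.\<close>

lemma p_irregular_translation:
  fixes \<Gamma> :: "('a::alg_closed_field ^ 2 ^ 2) set set"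
  assumes "prime p" "CHAR('a) = p" "p_irregular p \<Gamma>"
  shows "\<exists>A S b. invertible A \<and> invertible S \<and> b \<noteq> 0 \<and> (\<exists>\<alpha>\<in>\<Gamma>. A \<in> \<alpha>) \<and> A ** S = S ** upper b 1"
proof -
  let ?G = "PGL2 (UNIV :: 'a set)"
  interpret group ?G by (rule group_PGL2_UNIV)
  have \<Gamma>: "subgroup \<Gamma> ?G" "finite \<Gamma>" "p dvd card \<Gamma>"
    using assms(3) by (auto simp: p_irregular_def)
  obtain \<alpha> where \<alpha>: "\<alpha> \<in> \<Gamma>" "\<alpha> \<noteq> \<one>\<^bsub>?G\<^esub>" "\<alpha> [^]\<^bsub>?G\<^esub> p = \<one>\<^bsub>?G\<^esub>"
    using cauchy_group[OF subgroup_imp_group[OF \<Gamma>(1)] _ assms(1)] \<Gamma>(2,3)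
    by (auto simp: Coset.order_def nat_pow_consistent[symmetric])
  have one: "\<one>\<^bsub>?G\<^esub> = scalars"
    by (simp add: PGL2_UNIV_eq FactGroup_def)
  obtain A0 where A0: "invertible A0" "\<alpha> = proj A0"
    using \<alpha>(1) subgroup.subset[OF \<Gamma>(1)] unfolding PGL2_UNIV_carrier by blast
  obtain c S b m where c: "c \<noteq> 0" and S: "invertible S"
    and conj: "(mat c ** A0) ** S = S ** upper b m"
    using projective_triangularization[OF A0(1)] by blast
  define A where "A = mat c ** A0"
  have A: "invertible A"
    using c A0(1) by (simp add: A_def matrix_inv_mult invertible_mat)
  have "A \<in> \<alpha>"
    using c by (auto simp: A_def A0(2) proj_eq)
  have "proj A = proj A0"
  proof (unfold proj_eq, intro equalityI subsetI)
    fix M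
    assume "M \<in> {mat d ** A |d. d \<noteq> 0}"
    then obtain d where d: "d \<noteq> 0" "M = mat d ** A" by blast
    then have "M = mat (d * c) ** A0"
      by (simp add: A_def matrix_mul_assoc mat_mult_mat)
    then show "M \<in> {mat d ** A0 |d. d \<noteq> 0}"
      using c d(1) by (intro CollectI exI[of _ "d * c"]) simp
  next
    fix M
    assume "M \<in> {mat d ** A0 |d. d \<noteq> 0}"
    then obtain d where d: "d \<noteq> 0" "M = mat d ** A0" by blast
    then have "M = mat (d / c) ** A"
      using c by (simp add: A_def matrix_mul_assoc mat_mult_mat)
    then show "M \<in> {mat d ** A |d. d \<noteq> 0}"
      using c d(1) by (intro CollectI exI[of _ "d / c"]) simp
  qed
  have pow: "\<exists>b'. (A [^]\<^bsub>GL2\<^esub> n) ** S = S ** upper b' (m ^ n)" for n :: nat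
  proof (induction n)
    case 0
    have "upper 0 1 = (mat 1 :: 'a ^ 2 ^ 2)"
      by (rule mat2_eqI) (simp_all add: mat_def)
    then show ?case
      by (auto simp: GL2_def intro!: exI[of _ 0])
  next
    case (Suc n)
    then obtain b' where b': "(A [^]\<^bsub>GL2\<^esub> n) ** S = S ** upper b' (m ^ n)" by blast
    have "(A [^]\<^bsub>GL2\<^esub> Suc n) ** S = (A [^]\<^bsub>GL2\<^esub> n) ** (A ** S)"
      by (simp add: GL2_def matrix_mul_assoc)
    also have "\<dots> = ((A [^]\<^bsub>GL2\<^esub> n) ** S) ** upper b m"
      using conj by (simp add: A_def matrix_mul_assoc)
    also have "\<dots> = S ** (upper b' (m ^ n) ** upper b m)"
      unfolding b' by (simp add: matrix_mul_assoc)
    finally show ?case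
      unfolding upper_mult by (auto simp: mult.commute)
  qed
  have cancel_S: "M = N" if "S ** M = S ** N" for M N
    using that matrix_inv_right_left(2)[OF S] by (metis matrix_mul_assoc matrix_mul_lid)
  have "A [^]\<^bsub>GL2\<^esub> p \<in> proj (A [^]\<^bsub>GL2\<^esub> p)"
    unfolding proj_eq by (auto intro!: exI[of _ 1])
  also have "\<dots> = scalars"
    using proj_pow[OF A, of p] \<alpha>(3) by (simp add: one \<open>proj A = proj A0\<close> A0(2))
  finally obtain e where "A [^]\<^bsub>GL2\<^esub> p = mat e"
    by (auto simp: scalars_def)
  then obtain b' where "S ** mat e = S ** upper b' (m ^ p)"
    using pow[of p] by (auto simp: scalar_mat_commute)
  then have e: "mat e = upper b' (m ^ p)"
    by (rule cancel_S)
  have "m ^ p = 1"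
    using arg_cong[OF e, of "\<lambda>M. M $ 1 $ 1"] arg_cong[OF e, of "\<lambda>M. M $ 2 $ 2"] by (simp add: mat_def)
  moreover have "(1 + (m - 1)) ^ p = 1 ^ p + (m - 1) ^ p"
    by (rule freshmans_dream) (simp_all add: assms(1,2))
  ultimately have m: "m = 1"
    by simp
  have "b \<noteq> 0"
  proof
    assume "b = 0"
    then have "upper b m = mat 1"
      using m by (intro mat2_eqI) (simp_all add: mat_def)
    then have "A ** S = S"
      using conj by (simp add: A_def)
    then have "A = mat 1"
      using matrix_inv_right_left(1)[OF S] by (metis matrix_mul_assoc matrix_mul_rid)
    then have "\<alpha> = scalars"
      using \<open>proj A = proj A0\<close> by (simp add: A0(2) flip: proj_eq) (auto simp: proj_eq scalars_def)
    then show False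
      using \<alpha>(2) one by simp
  qed
  then show ?thesis
    using A S \<alpha>(1) \<open>A \<in> \<alpha>\<close> conj m unfolding A_def by blast
qed

section \<open>The degree of a map that commutes with a translation\<close>

lemma coeff_pcompose_translation_top:
  fixes p :: "'a::field poly"
  assumes "degree p \<le> n"
  shows "coeff (pcompose p [:b, 1:]) n = coeff p n"
proof (cases "degree p = n")
  case True
  have "lead_coeff (pcompose p [:b, 1:]) = lead_coeff p"
    by (simp add: lead_coeff_comp)
  then show ?thesis
    using True by (simp add: degree_pcompose)
next
  case False
  then show ?thesis
    using assms by (simp add: coeff_eq_0 degree_pcompose)
qed

text \<open>In \<open>(x + b)\<^sup>k\<close> the coefficient of \<open>x\<^sup>k\<^sup>-\<^sup>1\<close> is \<open>k b\<close>.\<close>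

lemma coeff_pcompose_translation_next:
  fixes p :: "'a::field poly"
  assumes "degree p \<le> Suc n"
  shows "coeff (pcompose p [:b, 1:]) n = coeff p n + of_nat (Suc n) * b * coeff p (Suc n)"
  using assms
proof (induction n arbitrary: p)
  case 0
  obtain a r where p: "p = pCons a r" by (cases p)
  then have "degree r = 0"
    using 0 by (auto split: if_splits)
  then show ?case
    by (auto simp: p pcompose_pCons elim!: degree_eq_zeroE)
next
  case (Suc n)
  obtain a r where p: "p = pCons a r" by (cases p)
  then have "degree r \<le> Suc n"
    using Suc.prems by (auto split: if_splits)
  then show ?case
    using Suc.IH[of r] coeff_pcompose_translation_top[of r "Suc n" b]
    by (simp add: p pcompose_pCons algebra_simps)
qed

lemma poly_1_comp_mat_upper: "poly (comp_mat F (upper b 1)) 1 = pcompose (poly F 1) [:b, 1:]"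
proof (induction F rule: poly2_induct)
  case (const a)
  then show ?case
    unfolding comp_mat_simps by (simp add: const2_def pcompose_pCons)
next
  case (x F)
  then show ?case
    unfolding comp_mat_simps by (simp add: const2_def var_x_def var_y_def pcompose_pCons algebra_simps)
next
  case (y F)
  then show ?case
    unfolding comp_mat_simps by (simp add: const2_def var_x_def var_y_def)
qed (simp add: pcompose_add)

text \<open>Put \<open>p = P(x, 1)\<close> and \<open>q = Q(x, 1)\<close>. Equivariance says \<open>p(x + b) = p + b q\<close> and
  \<open>q(x + b) = q\<close> up to a common constant. Comparing coefficients of \<open>x\<^sup>d\<close> shows that
  the constant is \<open>1\<close> and that \<open>q\<close> has degree less than \<open>d\<close>; the next coefficient of \<open>p\<close> and of \<open>q\<close> then gives the claim.\<close>

lemma translation_equivariant_degree: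
  fixes P Q :: "'a::field poly2"
  assumes hom: "homogeneous d P" "homogeneous d Q"
    and nz: "\<not> (var_y dvd P \<and> var_y dvd Q)" and "b \<noteq> 0"
    and equi: "conj_pair (upper b 1) (P, Q) = (const2 c * P, const2 c * Q)"
  shows "(of_nat (d * (d - 1)) :: 'a) = 0"
proof (cases "d \<ge> 2")
  case False
  then have "d = 0 \<or> d = 1" by linarith
  then show ?thesis by auto
next
  case True
  then obtain n where d: "d = Suc (Suc n)"
    by (metis add_2_eq_Suc le_Suc_ex)
  define p where "p = poly P 1"
  define q where "q = poly Q 1"
  have coeff_p: "coeff p i = (if i \<le> d then coeff (coeff P (d - i)) i else 0)"
    and coeff_q: "coeff q i = (if i \<le> d then coeff (coeff Q (d - i)) i else 0)" for i
    using hom[THEN coeff_poly_1_homogeneous] by (simp_all add: p_def q_def)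
  have deg: "degree p \<le> d" "degree q \<le> d"
    using coeff_p coeff_q by (simp_all add: degree_le)
  have top: "coeff p d \<noteq> 0 \<or> coeff q d \<noteq> 0"
    using nz hom var_y_dvd_homogeneous_iff by (auto simp: coeff_p coeff_q)
  have inv: "invertible (upper b 1)"
    by (simp add: invertible_2x2_iff)
  have "comp_mat P (upper b 1) = const2 c * P + const2 b * (const2 c * Q)"
    "comp_mat Q (upper b 1) = const2 c * Q"
    using equi unfolding conj_pair_eq_iff[OF inv] by simp_all
  from this[THEN arg_cong, of "\<lambda>F. poly F 1"]
  have p: "pcompose p [:b, 1:] = smult c (p + smult b q)" and q: "pcompose q [:b, 1:] = smult c q"
    unfolding poly_1_comp_mat_upper by (simp_all add: p_def q_def const2_def smult_add_right mult.commute)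
  have 1: "coeff p d = c * (coeff p d + b * coeff q d)"
    using coeff_pcompose_translation_top[OF deg(1), of b] unfolding p by simp
  have 2: "coeff q d = c * coeff q d"
    using coeff_pcompose_translation_top[OF deg(2), of b] unfolding q by simp
  have c: "c = 1"
    using 1 2 top by (cases "coeff q d = 0") auto
  have q0: "coeff q d = 0"
    using 1 \<open>b \<noteq> 0\<close> by (simp add: c)
  have "degree q \<le> Suc n"
    using q0 deg(2) unfolding d by (metis coeff_0_degree_minus_1 diff_Suc_1 leading_coeff_neq_0 le_Suc_eq)
  then have 3: "of_nat (Suc n) * coeff q (Suc n) = 0"
    using coeff_pcompose_translation_next[of q n b] \<open>b \<noteq> 0\<close> unfolding q c by simp
  have "b * (of_nat d * coeff p d) = b * coeff q (Suc n)"
    using coeff_pcompose_translation_next[of p "Suc n" b] deg(1) unfolding p c d by (simp add: algebra_simps)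
  then have "of_nat d * coeff p d = coeff q (Suc n)"
    using \<open>b \<noteq> 0\<close> by simp
  then have "of_nat (Suc n) * (of_nat d * coeff p d) = 0"
    using 3 by simp
  then have "of_nat (Suc n) * of_nat d * coeff p d = 0"
    by (simp only: mult.assoc)
  moreover have "coeff p d \<noteq> 0"
    using top q0 by simp
  ultimately have "of_nat (Suc n) * (of_nat d :: 'a) = 0"
    by (metis mult_eq_0_iff)
  then show ?thesis
    unfolding d of_nat_mult diff_Suc_1 by (simp only: mult.commute)
qed

text \<open>A change of coordinates turns the element of order \<open>p\<close> into a translation. The new pair still has no
  common factor \<open>y\<close>, since the old one has no common linear factor.\<close>

lemma p_irregular_degree:
  fixes P Q :: "'a::alg_closed_field poly2"
  assumes p: "prime p" "CHAR('a) = p" "p_irregular p \<Gamma>"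
    and f: "f \<in> rational_maps" "(P, Q) \<in> f" "\<Gamma> \<subseteq> Aut f"
    and PQ: "coprime P Q" "homogeneous d P" "homogeneous d Q"
  shows "p dvd d * (d - 1)"
proof -
  obtain A S b \<alpha> where A: "invertible A" "A \<in> \<alpha>" "\<alpha> \<in> \<Gamma>" and S: "invertible S" and "b \<noteq> 0"
    and conj: "A ** S = S ** upper b 1"
    using p_irregular_translation[OF p] by blast
  obtain c where c: "conj_pair A (P, Q) = (const2 c * P, const2 c * Q)"
    using conj_pair_eigenvalue[OF f(1,2) PQ A(1,2)] A(3) f(3) by blast
  obtain P' Q' where *: "conj_pair S (P, Q) = (P', Q')" by (cases "conj_pair S (P, Q)")
  have inv: "invertible (upper b 1)"
    by (simp add: invertible_2x2_iff)
  have "conj_pair (upper b 1) (P', Q') = conj_pair (S ** upper b 1) (P, Q)"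
    by (simp add: conj_pair_mult[OF S inv] *)
  also have "\<dots> = conj_pair S (conj_pair A (P, Q))"
    by (simp add: conj_pair_mult[OF A(1) S] flip: conj)
  also have "\<dots> = (const2 c * P', const2 c * Q')"
    by (simp add: c conj_pair_const2_mult *)
  finally have equi: "conj_pair (upper b 1) (P', Q') = (const2 c * P', const2 c * Q')" .
  have "\<not> (var_y dvd P' \<and> var_y dvd Q')"
  proof
    assume "var_y dvd P' \<and> var_y dvd Q'"
    then have "var_y dvd comp_mat P S" "var_y dvd comp_mat Q S"
      using * unfolding conj_pair_eq_iff[OF S] by simp_all
    then have "comp_mat var_y (matrix_inv S) dvd P" "comp_mat var_y (matrix_inv S) dvd Q"
      using comp_mat_dvd comp_mat_matrix_inv(1)[OF S] by metis+
    then have "is_unit (comp_mat var_y (matrix_inv S))"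
      using PQ(1) coprime_common_divisor by blast
    moreover have "linear_form (comp_mat var_y (matrix_inv S))"
      using invertible_matrix_inv[OF S] by (auto simp: linear_form_def)
    ultimately show False
      using prime_elem_linear_form prime_elem_not_unit by blast
  qed
  then have "(of_nat (d * (d - 1)) :: 'a) = 0"
    using translation_equivariant_degree conj_pair_homogeneous[OF PQ(2,3) *] \<open>b \<noteq> 0\<close> equi by blast
  then show ?thesis
    using p(2) by (simp only: of_nat_eq_0_iff_char_dvd)
qed

section \<open>The correspondence\<close>

lemma invariants_of_irregular_map:
  fixes f :: "('a::alg_closed_field poly2 \<times> 'a poly2) set"
  assumes p: "prime p" "p > 2" "CHAR('a) = p" "p_irregular p \<Gamma>"
    and f: "f \<in> rational_maps" "\<Gamma> \<subseteq> Aut f" and d: "ratmap_degree f \<ge> 2"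
  shows "\<exists>F G \<psi> m n. is_character (SL2_preimage k \<Gamma>) \<psi> \<and>
    relatively_invariant (SL2_preimage k \<Gamma>) \<psi> F \<and> relatively_invariant (SL2_preimage k \<Gamma>) \<psi> G \<and>
    homogeneous m F \<and> homogeneous n G \<and>
    m + 1 = ratmap_degree f \<and> n = ratmap_degree f + 1 \<and>
    f = ratmap (var_x * F + d_dy G) (var_y * F - d_dx G)"
proof -
  let ?H = "SL2_preimage k \<Gamma>"
  define d where "d = ratmap_degree f"
  obtain P Q where PQ_f: "(P, Q) \<in> f" and PQ: "coprime P Q" "homogeneous d P" "homogeneous d Q"
    using exists_coprime_coordinates[OF f(1)] unfolding d_def by blast
  have nz: "P \<noteq> 0 \<or> Q \<noteq> 0"
    using PQ(1) by auto
  have d2: "d \<ge> 2"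
    using d by (simp add: d_def)
  \<comment> \<open>If \<open>p\<close> divided \<open>d + 1\<close> then \<open>d (d - 1)\<close> would be \<open>2\<close> modulo \<open>p\<close>.\<close>
  have "(of_nat (d + 1) :: 'a) \<noteq> 0"
  proof
    assume "(of_nat (d + 1) :: 'a) = 0"
    then have 1: "p dvd d + 1"
      using p(3) by (simp only: of_nat_eq_0_iff_char_dvd)
    have "p dvd d * (d - 1)"
      using p_irregular_degree[OF p(1,3,4) f(1) PQ_f f(2) PQ] .
    then have "p dvd d * (d - 1) + 2 * (d + 1)"
      by (rule dvd_add[OF _ dvd_mult[OF 1]])
    moreover have "d * (d - 1) + 2 * (d + 1) = d * (d + 1) + 2"
      using d2 by (auto simp: le_iff_add algebra_simps)
    ultimately have "p dvd 2"
      using 1 by (metis dvd_add_right_iff dvd_mult)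
    then show False
      using p(2) by (auto dest: dvd_imp_le)
  qed
  then obtain r where r: "r * (of_nat (d + 1) :: 'a) = 1"
    by (metis left_inverse)
  have H: "invertible A" "det A = 1" "A \<in> proj A" "proj A \<in> Aut f" if "A \<in> ?H" for A
    using that f(2) by (auto simp: SL2_preimage_def SL2_def invertible_det_nz proj_eq intro: exI[of _ 1])
  \<comment> \<open>The eigenvalue is chosen for arbitrary matrices, so that it is already known for a product once
    it is known for the factors.\<close>
  define \<psi> where "\<psi> A = (SOME c. c \<noteq> 0 \<and> conj_pair A (P, Q) = (const2 c * P, const2 c * Q))" for A
  have \<psi>: "\<psi> A \<noteq> 0" "conj_pair A (P, Q) = (const2 (\<psi> A) * P, const2 (\<psi> A) * Q)" if "A \<in> ?H" for A
    using someI_ex[OF conj_pair_eigenvalue[OF f(1) PQ_f PQ H(1,3,4)[OF that]]]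
    unfolding \<psi>_def by blast+
  have "\<psi> (A ** B) = \<psi> A * \<psi> B" if "A \<in> ?H" "B \<in> ?H" for A B
  proof -
    have AB: "conj_pair (A ** B) (P, Q) = (const2 (\<psi> A * \<psi> B) * P, const2 (\<psi> A * \<psi> B) * Q)"
      using that by (simp add: conj_pair_mult H \<psi> conj_pair_const2_mult)
    have "\<psi> A * \<psi> B \<noteq> 0"
      using \<psi>(1) that by simp
    with AB have "\<exists>c. c \<noteq> 0 \<and> conj_pair (A ** B) (P, Q) = (const2 c * P, const2 c * Q)"
      by blast
    from someI_ex[OF this]
    have "conj_pair (A ** B) (P, Q) = (const2 (\<psi> (A ** B)) * P, const2 (\<psi> (A ** B)) * Q)"
      unfolding \<psi>_def[of "A ** B"] by blast
    then have "const2 (\<psi> (A ** B)) * P = const2 (\<psi> A * \<psi> B) * P"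
      "const2 (\<psi> (A ** B)) * Q = const2 (\<psi> A * \<psi> B) * Q"
      unfolding AB prod.inject by metis+
    then show ?thesis
      using nz by (metis const2_simps(7) mult_right_cancel)
  qed
  then have char: "is_character ?H \<psi>"
    using \<psi>(1) by (auto simp: is_character_def hom_def mult_group_def GL2_def)
  define F where "F = const2 r * (d_dx P + d_dy Q)"
  define G where "G = const2 r * (var_y * P - var_x * Q)"
  have "relatively_invariant ?H \<psi> F" "relatively_invariant ?H \<psi> G"
    unfolding relatively_invariant_def F_def G_def
    by (intro ballI, simp only: comp_mat_simps(2,4) comp_mat_divergence[OF H(2) \<psi>(2)]
        comp_mat_determinant[OF H(2) \<psi>(2)] mult.left_commute)+
  moreover have "homogeneous (d - 1) F" "homogeneous (d + 1) G"
    using PQ(2,3) homogeneous_d_dx[OF PQ(2)] homogeneous_d_dy[OF PQ(3)] unfolding F_def G_def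
    by (auto intro!: homogeneous_const2_mult homogeneous_add homogeneous_diff
        homogeneous_var_x_mult homogeneous_var_y_mult)
  moreover have "f = ratmap (var_x * F + d_dy G) (var_y * F - d_dx G)"
    unfolding F_def G_def pair_from_determinant_divergence[OF PQ(2,3) r]
    by (rule ratmap_cases(2)[OF f(1) PQ_f])
  moreover have "d - 1 + 1 = d"
    using d2 by simp
  ultimately show ?thesis
    using char unfolding d_def by blast
qed

lemma invariants_give_automorphism:
  fixes F G :: "'a::alg_closed_field poly2"
  defines "P \<equiv> var_x * F + d_dy G" and "Q \<equiv> var_y * F - d_dx G"
  assumes A: "det A = 1" "comp_mat F A = const2 c * F" "comp_mat G A = const2 c * G"
    and PQ: "(P, Q) \<in> form_pairs"
  shows "proj A \<in> Aut (ratmap P Q)"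
proof (rule proj_in_Aut[OF _ PQ])
  show inv: "invertible A"
    using A(1) by (simp add: invertible_det_nz)
  have "conj_pair A (P, Q) = (const2 c * P, const2 c * Q)"
    unfolding P_def Q_def by (rule conj_pair_of_invariants[OF A])
  then show "(conj_pair A (P, Q), (P, Q)) \<in> form_pairs_rel"
    using conj_pair_form_pairs[OF inv PQ] PQ by (simp add: form_pairs_rel_def)
qed

theorem theorem3p2:
  fixes p q :: nat
  assumes "prime p"
    and "\<exists>n\<ge>1. q = p ^ n"
    and "is_alg_closure_Fp p TYPE('a::alg_closed_field)"
  shows
    "(p > 2 \<longrightarrow>
        (\<forall>\<Gamma> :: ('a ^ 2 ^ 2) set set.
           subgroup \<Gamma> (PGL2 (Fq q)) \<and> p_irregular p \<Gamma> \<longrightarrow>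
           (\<forall>f \<in> rational_maps.
              ratmap_degree f \<ge> 2 \<and> \<Gamma> \<subseteq> Aut f \<longrightarrow>
              (\<exists>F G \<psi> m n.
                 is_character (SL2_preimage (Fq (q ^ 2)) \<Gamma>) \<psi> \<and>
                 relatively_invariant (SL2_preimage (Fq (q ^ 2)) \<Gamma>) \<psi> F \<and>
                 relatively_invariant (SL2_preimage (Fq (q ^ 2)) \<Gamma>) \<psi> G \<and>
                 homogeneous m F \<and> homogeneous n G \<and>
                 m + 1 = ratmap_degree f \<and> n = ratmap_degree f + 1 \<and>
                 f = ratmap (var_x * F + d_dy G) (var_y * F - d_dx G)))))
     \<and>
     (\<forall>(\<Gamma> :: ('a ^ 2 ^ 2) set) \<psi> F G m n d.
        subgroup \<Gamma> (SL2 (Fq q)) \<and>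
        is_character \<Gamma> \<psi> \<and>
        relatively_invariant \<Gamma> \<psi> F \<and> relatively_invariant \<Gamma> \<psi> G \<and>
        homogeneous m F \<and> homogeneous n G \<and>
        var_x * F + d_dy G \<noteq> 0 \<and> var_y * F - d_dx G \<noteq> 0 \<and>
        homogeneous d (var_x * F + d_dy G) \<and> homogeneous d (var_y * F - d_dx G) \<longrightarrow>
        proj ` \<Gamma> \<subseteq> Aut (ratmap (var_x * F + d_dy G) (var_y * F - d_dx G)))"
proof (intro conjI impI allI ballI)
  have char: "CHAR('a) = p"
    using assms(3) by (simp add: is_alg_closure_Fp_def)
  fix \<Gamma> :: "('a ^ 2 ^ 2) set set" and f :: "('a poly2 \<times> 'a poly2) set"
  assume "p > 2" and \<Gamma>: "subgroup \<Gamma> (PGL2 (Fq q)) \<and> p_irregular p \<Gamma>"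
    and "f \<in> rational_maps" and f: "ratmap_degree f \<ge> 2 \<and> \<Gamma> \<subseteq> Aut f"
  then show "\<exists>F G \<psi> m n.
      is_character (SL2_preimage (Fq (q ^ 2)) \<Gamma>) \<psi> \<and>
      relatively_invariant (SL2_preimage (Fq (q ^ 2)) \<Gamma>) \<psi> F \<and>
      relatively_invariant (SL2_preimage (Fq (q ^ 2)) \<Gamma>) \<psi> G \<and>
      homogeneous m F \<and> homogeneous n G \<and>
      m + 1 = ratmap_degree f \<and> n = ratmap_degree f + 1 \<and>
      f = ratmap (var_x * F + d_dy G) (var_y * F - d_dx G)"
    by (intro invariants_of_irregular_map[OF assms(1) _ char]) auto
next
  fix \<Gamma> :: "('a ^ 2 ^ 2) set" and \<psi> F G m n d
  assume *: "subgroup \<Gamma> (SL2 (Fq q)) \<and>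
    is_character \<Gamma> \<psi> \<and>
    relatively_invariant \<Gamma> \<psi> F \<and> relatively_invariant \<Gamma> \<psi> G \<and>
    homogeneous m F \<and> homogeneous n G \<and>
    var_x * F + d_dy G \<noteq> 0 \<and> var_y * F - d_dx G \<noteq> 0 \<and>
    homogeneous d (var_x * F + d_dy G) \<and> homogeneous d (var_y * F - d_dx G)"
  then have pair: "(var_x * F + d_dy G, var_y * F - d_dx G) \<in> form_pairs"
    by (auto simp: form_pairs_def)
  show "proj ` \<Gamma> \<subseteq> Aut (ratmap (var_x * F + d_dy G) (var_y * F - d_dx G))"
  proof (rule image_subsetI)
    fix A
    assume "A \<in> \<Gamma>"
    moreover have "\<Gamma> \<subseteq> carrier (SL2 (Fq q))"
      using * subgroup.subset by blast
    ultimately have "det A = 1"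
      by (auto simp: SL2_def)
    then show "proj A \<in> Aut (ratmap (var_x * F + d_dy G) (var_y * F - d_dx G))"
      using * \<open>A \<in> \<Gamma>\<close>
      by (intro invariants_give_automorphism[OF _ _ _ pair]) (auto simp: relatively_invariant_def)
  qed
qed

end
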